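(* Let $\rho$ be the autocovariance function of the weakly stationary solution $X$ of the ARCH($\infty$) equations with data $a$, $b$, $\xi$. Suppose that $\lambda_1B<1$ and $\Omega<1$. Then $$\rho(k)=\lambda_1\sum_{j=-\infty}^{k-1}b(k-j)\rho(j)\quad\text{for } k\in\{1,2,3,\dots\},\qquad \rho(k)=\rho(-k)\quad\text{for } k\in\{-1,-2,-3,\dots\},$$ and $$\rho(0)=\left(\frac{a\sigma}{1-\lambda_1B}\right)^2\frac{1}{1-\Omega^2}\sum_{j=0}^\infty z(j)^2=\left(\frac{a\sigma}{1-\lambda_1B}\right)^2\frac{1+\lambda_1^2\Omega^2/\sigma^2}{1-\Omega^2}.$$
   Context: ARCH($\infty$) setting. Let $\xi=\{\xi(k)\}_{k\in\mathbb{Z}}$ be i.i.d. non-negative random variables, $a\ge 0$ a constant, and $b=\{b(j)\}_{j\ge1}$ a real sequence with $b(j)\ge 0$. A random sequence $X=\{X(k)\}_{k\in\mathbb{Z}}$ satisfies the ARCH($\infty$) equations if $X(k)=\varsigma(k)\xi(k)$, $\varsigma(k)=a+\sum_{j=1}^\infty b(j)X(k-j)$ for all $k\in\mathbb{Z}$. Put $\lambda_1=\mathbb{E}[\xi(0)]$, $\lambda_2=\mathbb{E}[\xi(0)^2]$, $\sigma^2=\mathrm{Var}[\xi(0)]=\lambda_2-\lambda_1^2$, $B=\sum_{j=1}^\infty b(j)$, $\nu(k)=X(k)-\lambda_1\varsigma(k)$. Standing assumptions: $\lambda_1\in(0,\infty)$, $a>0$, $\sigma\in(0,\infty)$, and $b$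 is not identically zero. The sequence $z$ is defined by $z(0)=1$, $z(n)=\lambda_1\sum_{j=0}^{n-1}b(n-j)z(j)$ for $n\ge 1$ (when $\lambda_1B<1$, these are the power series coefficients of $1/(1-\lambda_1\sum_{j\ge1}b(j)\lambda^j)$ on $|\lambda|\le 1$), and $\Omega=\frac{\sigma}{\lambda_1}\big(\sum_{j=1}^\infty z(j)^2\big)^{1/2}$. A process is (weakly) stationary if it has constant finite mean and $\mathrm{Cov}[X(n),X(n+k)]$ depends only on $k$; $\rho(k)=\mathrm{Cov}[X(n),X(n+k)]$, $k\in\mathbb{Z}$, is its autocovariance function. Known fact (recalled by the paper): if $\lambda_1B<1$ and $\Omega<1$, there is a unique weakly stationary solution $X$ of the ARCH($\infty$) equations; it satisfies $\rho(k)=\mathbb{E}[\nu(0)^2]\sum_{j=0}^\infty z(j)z(j+|k|)$ for $k\in\mathbb{Z}$, with $\mathbb{E}[\nu(0)^2]=\big(\frac{a\sigma}{1-\lambda_1B}\big)^2\frac{1}{1-\Omega^2}$. *)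

theory Defs
  imports "HOL-Probability.Probability"
begin

definition covariance :: "'w measure \<Rightarrow> ('w \<Rightarrow> real) \<Rightarrow> ('w \<Rightarrow> real) \<Rightarrow> real" where
  "covariance M Y Z =
     prob_space.expectation M
       (\<lambda>\<omega>. (Y \<omega> - prob_space.expectation M Y) * (Z \<omega> - prob_space.expectation M Z))"

definition iid :: "'w measure \<Rightarrow> ('i \<Rightarrow> 'w \<Rightarrow> real) \<Rightarrow> bool" where
  "iid M \<xi> \<longleftrightarrow>
     prob_space.indep_vars M (\<lambda>_. borel) \<xi> UNIV \<and>
     (\<forall>k l. distr M borel (\<xi> k) = distr M borel (\<xi> l))"

(* Square integrability makes the covariances genuine: the Bochner integral of a
   non-integrable function is 0. *)
definition weakly_stationary :: "'w measure \<Rightarrow> (int \<Rightarrow> 'w \<Rightarrow> real) \<Rightarrow> bool" where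
  "weakly_stationary M X \<longleftrightarrow>
     (\<forall>n. X n \<in> borel_measurable M \<and> integrable M (X n) \<and> integrable M (\<lambda>\<omega>. (X n \<omega>)\<^sup>2)) \<and>
     (\<forall>m n. prob_space.expectation M (X m) = prob_space.expectation M (X n)) \<and>
     (\<forall>m n k. covariance M (X m) (X (m + k)) = covariance M (X n) (X (n + k)))"

(* For a weakly stationary X the base point 0 can be replaced by any integer. *)
definition autocovariance :: "'w measure \<Rightarrow> (int \<Rightarrow> 'w \<Rightarrow> real) \<Rightarrow> int \<Rightarrow> real" where
  "autocovariance M X k = covariance M (X 0) (X (0 + k))"

(* Throughout, the sequence b is indexed by 1, 2, ...; the value b 0 is never used,
   and a sum over j = 1, 2, ... is written as a sum over Suc j. *)

definition arch_volatility ::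
    "real \<Rightarrow> (nat \<Rightarrow> real) \<Rightarrow> (int \<Rightarrow> 'w \<Rightarrow> real) \<Rightarrow> int \<Rightarrow> 'w \<Rightarrow> real" where
  "arch_volatility a b X k \<omega> = a + (\<Sum>j. b (Suc j) * X (k - int (Suc j)) \<omega>)"

(* Equations between random variables are understood almost surely, and the convergence
   of the series is part of being a solution. *)
definition arch_solution ::
    "'w measure \<Rightarrow> real \<Rightarrow> (nat \<Rightarrow> real) \<Rightarrow> (int \<Rightarrow> 'w \<Rightarrow> real) \<Rightarrow> (int \<Rightarrow> 'w \<Rightarrow> real) \<Rightarrow> bool" where
  "arch_solution M a b \<xi> X \<longleftrightarrow>
     (\<forall>k. X k \<in> borel_measurable M) \<and>
     (AE \<omega> in M. \<forall>k.
        summable (\<lambda>j. b (Suc j) * X (k - int (Suc j)) \<omega>) \<and>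
        X k \<omega> = arch_volatility a b X k \<omega> * \<xi> k \<omega>)"

function arch_z :: "real \<Rightarrow> (nat \<Rightarrow> real) \<Rightarrow> nat \<Rightarrow> real" where
  "arch_z l b n = (if n = 0 then 1 else l * (\<Sum>j<n. b (n - j) * arch_z l b j))"
  by pat_completeness auto
termination
  by (relation "Wellfounded.measure (\<lambda>(l, b, n). n)") auto

declare arch_z.simps [simp del]

(* The series converges when l * (\<Sum>j. b (Suc j)) < 1 and b is non-negative and summable:
   then z is itself summable. *)
definition arch_Omega :: "real \<Rightarrow> real \<Rightarrow> (nat \<Rightarrow> real) \<Rightarrow> real" where
  "arch_Omega s l b = s / l * sqrt (\<Sum>j. (arch_z l b (Suc j))\<^sup>2)"

end

theory Submission
  imports Defs
begin

text \<open>
  The formulas for \<open>\<rho>\<close> rest on a single probabilistic fact: \<open>\<nu>(k) = X(k) - lam1 * \<Sigma>(k)\<close>, where \<open>\<Sigma>\<close> is the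
  volatility, is orthogonal to the past of \<open>X\<close>. Since \<open>\<nu>(k) = \<Sigma>(k) * (\<xi>(k) - lam1)\<close>, this holds as soon as
  \<open>X(j)\<close> for \<open>j < k\<close> is a function of the innovations before time \<open>k\<close>. Causality is not part
  of being a solution of the ARCH equations and has to be proved; this is the harder half of the argument.

  Causality. Start the recursion with zero past at a remote time \<open>m\<close> and compare with \<open>X\<close>. The
  difference at time \<open>m + n\<close> is at most \<open>\<Sum>r. g(n + r) * \<bar>X(m - r)\<bar>\<close>, where \<open>g(i)\<close> is the response, \<open>i\<close> steps
  later, to a unit impulse (\<open>arch_path_error\<close>). Possible dependence of \<open>X(m - r)\<close> on later innovations
  rules out factoring the expectation, and Cauchy-Schwarz leaves the question whether the
  \<open>L\<^sup>2\<close> norms of the \<open>g(i)\<close> are summable. Resolving \<open>g\<close> along \<open>z\<close> writes it as an orthogonal sum, whose second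
  moments solve a renewal equation with kernel proportional to \<open>z(i)\<^sup>2\<close> and total mass \<open>\<Omega>\<^sup>2 < 1\<close>
  (\<open>arch_kick_second_moment\<close>). This makes the second moments summable, whereas their square roots are
  wanted. The missing ingredient is \<open>summable_sqrt_renewal\<close>: the solution of a renewal equation of mass
  less than one inherits summability of square roots from its kernel, and \<open>\<Sum>i. z(i)\<close> is finite because
  \<open>lam1 * B < 1\<close>. So the causal approximations converge to \<open>X\<close> in \<open>L\<^sup>1\<close>, and \<open>X\<close> is causal (\<open>causal\<close>).

  Covariances. Multiplying \<open>X(k) = lam1 * \<Sigma>(k) + \<nu>(k)\<close> by \<open>X(0)\<close> and taking expectations gives
  \<open>\<rho>(k) = lam1 * (\<Sum>j\<ge>1. b(j) * \<rho>(k - j)) + E[\<nu>(k) X(0)]\<close>. For \<open>k \<ge> 1\<close> the last term vanishes, which is the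
  claimed recursion. For \<open>k = -n \<le> 0\<close> it equals \<open>c * z(n)\<close> with \<open>c = E[\<nu>(0)\<^sup>2]\<close> (\<open>expectation_\<nu>_X\<close>), and pairing
  the resulting equations for \<open>\<rho>(n)\<close>, \<open>n \<ge> 0\<close>, with \<open>z\<close> telescopes to \<open>\<rho>(0) = c * (\<Sum>n. z(n)\<^sup>2)\<close>
  (\<open>weighted_renewal_sum\<close>). Finally \<open>c\<close> is determined by \<open>c = sig2 * E[\<Sigma>(0)\<^sup>2]\<close> and \<open>E[X(0)\<^sup>2] = lam2 * E[\<Sigma>(0)\<^sup>2]\<close>,
  where \<open>sig2\<close> and \<open>lam2\<close> are the variance and the second moment of \<open>\<xi>(0)\<close>.
\<close>

section \<open>The resolvent sequence z\<close>

lemma arch_z_0 [simp]: "arch_z l b 0 = 1"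
  by (subst arch_z.simps) simp

lemma arch_z_rec: "0 < n \<Longrightarrow> arch_z l b n = l * (\<Sum>j<n. b (n - j) * arch_z l b j)"
  by (subst arch_z.simps) simp

lemma arch_z_nonneg:
  assumes "l \<ge> 0" and "\<And>j. j \<ge> 1 \<Longrightarrow> b j \<ge> 0"
  shows "arch_z l b n \<ge> 0"
proof (induction n rule: less_induct)
  case (less n)
  show ?case
  proof (cases "n = 0")
    case False
    then show ?thesis
      using less assms by (subst arch_z_rec) (auto intro!: mult_nonneg_nonneg sum_nonneg)
  qed simp
qed

text \<open>
  The partial sums \<open>A\<close> of \<open>z\<close> satisfy \<open>A \<le> 1 + l * B * A\<close>, where \<open>B\<close> is the sum of \<open>b\<close>.
\<close>
lemma summable_arch_z:
  assumes l: "l \<ge> 0" and b: "\<And>j. j \<ge> 1 \<Longrightarrow> b j \<ge> 0"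
    and sb: "summable (\<lambda>j. b (Suc j))" and lB: "l * (\<Sum>j. b (Suc j)) < 1"
  shows "summable (arch_z l b)"
proof -
  let ?z = "arch_z l b" and ?B = "\<Sum>j. b (Suc j)"
  have z: "?z n \<ge> 0" for n
    using arch_z_nonneg[of l b n] l b by blast
  have B: "(\<Sum>i<n. b (Suc i)) \<le> ?B" for n
    by (rule sum_le_suminf[OF sb]) (auto simp: b)
  have "(\<Sum>n<N. ?z n) \<le> 1 / (1 - l * ?B)" for N
  proof (cases N)
    case 0
    then show ?thesis using lB by simp
  next
    case (Suc N')
    let ?A = "\<Sum>n<N. ?z n"
    have A0: "0 \<le> ?A" by (simp add: sum_nonneg z)
    have "?A = 1 + (\<Sum>n<N'. ?z (Suc n))"
      unfolding Suc by (simp add: sum.lessThan_Suc_shift del: sum.lessThan_Suc)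
    also have "(\<Sum>n<N'. ?z (Suc n)) = l * (\<Sum>n<N'. \<Sum>j<Suc n. b (Suc n - j) * ?z j)"
      by (simp add: arch_z_rec sum_distrib_left del: sum.lessThan_Suc)
    also have "(\<Sum>n<N'. \<Sum>j<Suc n. b (Suc n - j) * ?z j)
             = (\<Sum>j<N'. \<Sum>n\<in>{j..<N'}. b (Suc n - j) * ?z j)"
      by (subst sum.Sigma, simp, simp, subst sum.Sigma, simp, simp,
          rule sum.reindex_bij_witness[of _ "\<lambda>(j,n). (n,j)" "\<lambda>(n,j). (j,n)"]) auto
    also have "\<dots> = (\<Sum>j<N'. ?z j * (\<Sum>i<N' - j. b (Suc i)))"
    proof (rule sum.cong[OF refl])
      fix j assume "j \<in> {..<N'}"
      have "(\<Sum>n\<in>{j..<N'}. b (Suc n - j) * ?z j) = (\<Sum>i<N' - j. b (Suc i) * ?z j)"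
        by (rule sum.reindex_bij_witness[of _ "\<lambda>i. i + j" "\<lambda>n. n - j"])
          (auto simp: Suc_diff_le)
      then show "(\<Sum>n\<in>{j..<N'}. b (Suc n - j) * ?z j) = ?z j * (\<Sum>i<N' - j. b (Suc i))"
        by (simp add: sum_distrib_left mult.commute)
    qed
    also have "\<dots> \<le> (\<Sum>j<N'. ?z j * ?B)"
      by (intro sum_mono mult_left_mono B z)
    also have "\<dots> = (\<Sum>j<N'. ?z j) * ?B"
      by (simp add: sum_distrib_right)
    also have "\<dots> \<le> ?A * ?B"
      unfolding Suc using z B[of 0] by (intro mult_right_mono) auto
    finally have "?A \<le> 1 + l * (?A * ?B)"
      using l by (simp add: mult_left_mono)
    then show ?thesis
      using lB by (simp add: field_simps)
  qed
  then show ?thesis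
    by (intro bounded_imp_summable[where B = "1 / (1 - l * ?B)"]) (auto simp: z lessThan_Suc_atMost[symmetric] simp del: sum.lessThan_Suc)
qed

section \<open>Square roots of solutions of renewal equations\<close>

lemma sqrt_sum_le_sum_sqrt:
  assumes "\<And>i. i \<in> A \<Longrightarrow> (f i :: real) \<ge> 0"
  shows "sqrt (sum f A) \<le> (\<Sum>i\<in>A. sqrt (f i))"
  using assms
proof (induction A rule: infinite_finite_induct)
  case (insert x F)
  have "sqrt (f x + sum f F) \<le> sqrt (f x) + sqrt (sum f F)"
    using insert.prems by (intro sqrt_add_le_add_sqrt) (auto intro: sum_nonneg)
  with insert show ?case by force
qed auto

text \<open>
  Square roots are subadditive, so if \<open>\<Sum>n. sqrt (f n)\<close> were below 1, one could take square roots in the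
  equation and sum. Only \<open>\<Sum>n. f n\<close> is below 1, so the kernel is split at an index \<open>K\<close>. Beyond \<open>K\<close>
  the sum of the square roots is small and the naive argument applies. Up to \<open>K\<close> the convolution is absorbed
  pointwise: \<open>v\<close> is replaced by its smoothing \<open>V t = \<Sum>n\<le>t. \<theta> ^ (t - n) * v n\<close>, which solves the same kind
  of equation and loses at most a factor \<open>\<theta>\<close> per step, so \<open>V (t - i) \<le> V t / \<theta> ^ K\<close> for \<open>i \<le> K\<close>. With
  \<open>\<theta>\<close> close to 1 the near part of the kernel contributes at most \<open>(1 + F) / 2 * V t\<close>, and \<open>(1 + F) / 2 < 1\<close>.
\<close>
lemma summable_sqrt_renewal:
  fixes f v :: "nat \<Rightarrow> real"
  assumes f: "\<And>n. f n \<ge> 0" and f0: "f 0 = 0" and v: "\<And>n. v n \<ge> 0" and v0: "v 0 = 0"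
    and renewal: "\<And>n. v n = f n + (\<Sum>i\<le>n. f i * v (n - i))"
    and sqf: "summable (\<lambda>n. sqrt (f n))" and sf: "summable f" and F1: "(\<Sum>n. f n) < 1"
  shows "summable (\<lambda>n. sqrt (v n))"
proof -
  define F where "F = (\<Sum>n. f n)"
  have F: "0 \<le> F" "F < 1"
    unfolding F_def using F1 f by (auto intro: suminf_nonneg sf)
  \<comment> \<open>what is left of \<open>V t\<close> after absorbing the near part is \<open>\<delta>\<^sup>2 * V t\<close>\<close>
  define \<delta> where "\<delta> = sqrt ((1 - F) / 2)"
  have \<delta>: "\<delta> > 0" "\<delta>\<^sup>2 = (1 - F) / 2"
    using F by (auto simp: \<delta>_def)
  obtain K where "norm (\<Sum>i. sqrt (f (i + K))) < \<delta> / 2"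
    using suminf_exist_split[of "\<delta> / 2", OF _ sqf] \<delta> by auto
  then have K: "(\<Sum>i. sqrt (f (i + K))) < \<delta> / 2" by simp
  have tailK: "(\<Sum>i\<in>{K..T}. sqrt (f i)) \<le> \<delta> / 2" for T
  proof -
    have "(\<Sum>i\<in>{K..T}. sqrt (f i)) = (\<Sum>i<Suc T - K. sqrt (f (i + K)))"
      by (rule sum.reindex_bij_witness[of _ "\<lambda>i. i + K" "\<lambda>i. i - K"]) auto
    also have "\<dots> \<le> (\<Sum>i. sqrt (f (i + K)))"
      by (rule sum_le_suminf) (auto simp: f summable_iff_shift[of "\<lambda>n. sqrt (f n)" K] sqf)
    finally show ?thesis using K by simp
  qed
  \<comment> \<open>\<open>\<tau>\<close> is small enough that Bernoulli's inequality gives \<open>(1 - \<tau>) ^ K \<ge> (1 + F) / 2\<close>\<close>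
  define \<tau> where "\<tau> = (1 - F) / (2 * (real K + 1))"
  define \<theta> where "\<theta> = 1 - \<tau>"
  have \<tau>: "0 < \<tau>" "\<tau> < 1"
    using F by (auto simp: \<tau>_def field_simps)
  then have \<theta>: "0 < \<theta>" "\<theta> < 1"
    by (auto simp: \<theta>_def)
  have "real K * \<tau> \<le> (1 - F) / 2"
    using F by (simp add: \<tau>_def field_simps)
  then have "1 - (1 - F) / 2 \<le> 1 + real K * (- \<tau>)" by simp
  also have "\<dots> \<le> \<theta> ^ K"
    using Bernoulli_inequality[of "- \<tau>" K] \<tau> by (simp add: \<theta>_def)
  finally have \<theta>K: "(1 + F) / 2 \<le> \<theta> ^ K" by (simp add: field_simps)
  have F\<theta>: "F \<le> (1 + F) / 2 * \<theta> ^ K"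
  proof -
    have "F \<le> (1 + F) / 2 * ((1 + F) / 2)"
      using sum_squares_ge_zero[of "1 - F" 0] by (simp add: field_simps)
    also have "\<dots> \<le> (1 + F) / 2 * \<theta> ^ K"
      using \<theta>K F by (intro mult_left_mono) auto
    finally show ?thesis .
  qed
  define V where "V t = (\<Sum>n\<le>t. \<theta> ^ (t - n) * v n)" for t
  define W where "W t = (\<Sum>n\<le>t. \<theta> ^ (t - n) * f n)" for t
  have V_Suc: "V (Suc t) = v (Suc t) + \<theta> * V t" for t
    by (simp add: V_def sum_distrib_left Suc_diff_le mult.assoc)
  have W_Suc: "W (Suc t) = f (Suc t) + \<theta> * W t" for t
    by (simp add: W_def sum_distrib_left Suc_diff_le mult.assoc)
  have V0: "V 0 = 0" by (simp add: V_def v0)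
  have V_nn: "V t \<ge> 0" and W_nn: "W t \<ge> 0" for t
    using \<theta> v f by (auto simp: V_def W_def intro!: sum_nonneg)
  have V_conv: "V t = W t + (\<Sum>i\<le>t. f i * V (t - i))" for t
  proof (induction t)
    case (Suc t)
    have "V (Suc t) = f (Suc t) + (\<Sum>i\<le>Suc t. f i * v (Suc t - i))
        + \<theta> * (W t + (\<Sum>i\<le>t. f i * V (t - i)))"
      using Suc renewal[of "Suc t"] by (simp add: V_Suc)
    also have "\<dots> = W (Suc t) + (\<Sum>i\<le>t. f i * (v (Suc t - i) + \<theta> * V (t - i)))"
      by (simp add: W_Suc v0 distrib_left sum.distrib sum_distrib_left algebra_simps)
    also have "(\<Sum>i\<le>t. f i * (v (Suc t - i) + \<theta> * V (t - i))) = (\<Sum>i\<le>t. f i * V (Suc t - i))"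
      by (intro sum.cong refl) (simp add: Suc_diff_le V_Suc)
    finally show ?case by (simp add: V0)
  qed (simp add: V0 W_def f0)
  have V_back: "\<theta> ^ i * V t \<le> V (t + i)" for i t
  proof (induction i)
    case (Suc i)
    have "\<theta> ^ Suc i * V t \<le> \<theta> * V (t + i)"
      using Suc \<theta> by (simp add: mult.assoc)
    also have "\<dots> \<le> V (t + Suc i)" using v by (simp add: V_Suc)
    finally show ?case .
  qed simp
  have near: "(\<Sum>i\<in>{..t} - {K..t}. f i * V (t - i)) \<le> (1 + F) / 2 * V t" for t
  proof -
    have "\<theta> ^ K * (\<Sum>i\<in>{..t} - {K..t}. f i * V (t - i)) \<le> (\<Sum>i\<in>{..t} - {K..t}. f i * V t)"
      unfolding sum_distrib_left
    proof (rule sum_mono)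
      fix i assume i: "i \<in> {..t} - {K..t}"
      then have "\<theta> ^ K * V (t - i) \<le> \<theta> ^ i * V (t - i)"
        using \<theta> V_nn by (intro mult_right_mono power_decreasing) auto
      also have "\<dots> \<le> V t" using V_back[of i "t - i"] i by auto
      finally show "\<theta> ^ K * (f i * V (t - i)) \<le> f i * V t"
        using f[of i] by (simp add: mult.left_commute mult_left_mono)
    qed
    also have "\<dots> = (\<Sum>i\<in>{..t} - {K..t}. f i) * V t" by (simp add: sum_distrib_right)
    also have "\<dots> \<le> F * V t"
      unfolding F_def by (intro mult_right_mono sum_le_suminf) (auto simp: f sf V_nn)
    also have "\<dots> \<le> \<theta> ^ K * ((1 + F) / 2 * V t)"
      using mult_right_mono[OF F\<theta> V_nn[of t]] by (simp add: mult_ac)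
    finally show ?thesis using \<theta> by simp
  qed
  have sqV: "\<delta> * sqrt (V t) \<le> sqrt (W t) + (\<Sum>i\<in>{K..t}. sqrt (f i) * sqrt (V (t - i)))" for t
  proof -
    have "V t = W t + (\<Sum>i\<in>{..t} - {K..t}. f i * V (t - i)) + (\<Sum>i\<in>{K..t}. f i * V (t - i))"
      using V_conv[of t] sum.subset_diff[of "{K..t}" "{..t}" "\<lambda>i. f i * V (t - i)"] by auto
    with near[of t] have "\<delta>\<^sup>2 * V t \<le> W t + (\<Sum>i\<in>{K..t}. f i * V (t - i))"
      unfolding \<delta>(2) by (simp add: field_simps)
    have "\<delta> * sqrt (V t) = sqrt (\<delta>\<^sup>2 * V t)"
      using \<delta>(1) by (simp add: real_sqrt_mult)
    also have "sqrt (\<delta>\<^sup>2 * V t) \<le> sqrt (W t + (\<Sum>i\<in>{K..t}. f i * V (t - i)))"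
      by (rule real_sqrt_le_mono) fact
    also have "\<dots> \<le> sqrt (W t) + sqrt (\<Sum>i\<in>{K..t}. f i * V (t - i))"
      by (intro sqrt_add_le_add_sqrt W_nn sum_nonneg mult_nonneg_nonneg f V_nn)
    also have "sqrt (\<Sum>i\<in>{K..t}. f i * V (t - i)) \<le> (\<Sum>i\<in>{K..t}. sqrt (f i) * sqrt (V (t - i)))"
      unfolding real_sqrt_mult[symmetric]
      by (intro sqrt_sum_le_sum_sqrt mult_nonneg_nonneg f V_nn)
    finally show ?thesis by simp
  qed
  have sW: "summable (\<lambda>t. sqrt (W t))"
  proof (rule summable_comparison_test')
    have "summable (\<lambda>n. norm (sqrt \<theta> ^ n))"
      using \<theta> by (simp add: norm_power summable_geometric)
    moreover have "summable (\<lambda>n. norm (sqrt (f n)))" using sqf f by simp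
    ultimately show "summable (\<lambda>t. \<Sum>n\<le>t. sqrt (f n) * sqrt \<theta> ^ (t - n))"
      by (intro summable_Cauchy_product)
  next
    fix t :: nat assume "0 \<le> t"
    have "sqrt (W t) \<le> (\<Sum>n\<le>t. sqrt (\<theta> ^ (t - n) * f n))"
      unfolding W_def using \<theta> f by (intro sqrt_sum_le_sum_sqrt) simp
    then show "norm (sqrt (W t)) \<le> (\<Sum>n\<le>t. sqrt (f n) * sqrt \<theta> ^ (t - n))"
      using W_nn by (simp add: real_sqrt_mult real_sqrt_power mult.commute)
  qed
  have "(\<Sum>t\<le>T. sqrt (V t)) \<le> 2 / \<delta> * (\<Sum>t. sqrt (W t))" for T
  proof -
    let ?A = "\<Sum>t\<le>T. sqrt (V t)"
    have A0: "?A \<ge> 0" by (simp add: sum_nonneg V_nn)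
    have "\<delta> * ?A \<le> (\<Sum>t\<le>T. sqrt (W t)) + (\<Sum>t\<le>T. \<Sum>i\<in>{K..t}. sqrt (f i) * sqrt (V (t - i)))"
      unfolding sum_distrib_left sum.distrib[symmetric] by (intro sum_mono sqV)
    also have "(\<Sum>t\<le>T. \<Sum>i\<in>{K..t}. sqrt (f i) * sqrt (V (t - i)))
        = (\<Sum>i\<in>{K..T}. \<Sum>s\<le>T - i. sqrt (f i) * sqrt (V s))"
      by (subst sum.Sigma, simp, simp, subst sum.Sigma, simp, simp,
          rule sum.reindex_bij_witness[of _ "\<lambda>(i,s). (i + s,i)" "\<lambda>(t,i). (i,t - i)"]) auto
    also have "\<dots> \<le> (\<Sum>i\<in>{K..T}. sqrt (f i) * ?A)"
      unfolding sum_distrib_left[symmetric]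
      by (intro sum_mono mult_left_mono sum_mono2) (auto simp: V_nn f)
    also have "\<dots> = (\<Sum>i\<in>{K..T}. sqrt (f i)) * ?A" by (simp add: sum_distrib_right)
    also have "\<dots> \<le> \<delta> / 2 * ?A" by (intro mult_right_mono tailK A0)
    also have "(\<Sum>t\<le>T. sqrt (W t)) \<le> (\<Sum>t. sqrt (W t))"
      by (rule sum_le_suminf[OF sW]) (auto simp: W_nn)
    finally show ?thesis using \<delta> by (simp add: field_simps)
  qed
  then have "summable (\<lambda>t. sqrt (V t))"
    by (intro bounded_imp_summable[where B = "2 / \<delta> * (\<Sum>t. sqrt (W t))"]) (auto simp: V_nn)
  then show ?thesis
  proof (rule summable_comparison_test')
    fix t :: nat assume "0 \<le> t"
    have "v t \<le> V t"
      unfolding V_def using member_le_sum[of t "{..t}" "\<lambda>n. \<theta> ^ (t - n) * v n"] \<theta> v by auto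
    then show "norm (sqrt (v t)) \<le> sqrt (V t)" using v by simp
  qed
qed

section \<open>The ARCH recursion with zero past\<close>

text \<open>
  The state at time \<open>n\<close> when the recursion starts from \<open>y0\<close> at time 0 and all earlier values are 0.
  Two instances matter: \<open>y0 = 0\<close> gives causal approximations of a solution, while \<open>y0 = 1\<close>, \<open>a = 0\<close> gives
  the response to a unit impulse.
\<close>
function arch_path :: "real \<Rightarrow> real \<Rightarrow> (nat \<Rightarrow> real) \<Rightarrow> (nat \<Rightarrow> real) \<Rightarrow> nat \<Rightarrow> real" where
  "arch_path y0 a b x n = (if n = 0 then y0 else x n * (a + (\<Sum>j<n. b (n - j) * arch_path y0 a b x j)))"
  by pat_completeness auto
termination
  by (relation "Wellfounded.measure (\<lambda>(y0, a, b, x, n). n)") auto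

declare arch_path.simps [simp del]

lemma arch_path_0 [simp]: "arch_path y0 a b x 0 = y0"
  by (subst arch_path.simps) simp

lemma arch_path_rec:
  "0 < n \<Longrightarrow> arch_path y0 a b x n = x n * (a + (\<Sum>j<n. b (n - j) * arch_path y0 a b x j))"
  by (subst arch_path.simps) simp

lemma measurable_arch_path:
  assumes "\<And>i. 1 \<le> i \<Longrightarrow> i \<le> n \<Longrightarrow> (\<lambda>\<omega>. x \<omega> i) \<in> borel_measurable N"
  shows "(\<lambda>\<omega>. arch_path y0 a b (x \<omega>) n) \<in> borel_measurable N"
  using assms
proof (induction n rule: less_induct)
  case (less n)
  show ?case
  proof (cases "n = 0")
    case False
    then have [measurable]: "(\<lambda>\<omega>. x \<omega> n) \<in> borel_measurable N"
      using less.prems[of n] by simp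
    have [measurable]: "(\<lambda>\<omega>. arch_path y0 a b (x \<omega>) j) \<in> borel_measurable N" if "j < n" for j
      using less that by simp
    show ?thesis
      using False by (subst arch_path_rec) measurable
  qed simp
qed

lemma arch_path_nonneg:
  assumes "y0 \<ge> 0" "a \<ge> 0" and "\<And>j. j \<ge> 1 \<Longrightarrow> b j \<ge> 0" and "\<And>i. x i \<ge> 0"
  shows "arch_path y0 a b x n \<ge> 0"
proof (induction n rule: less_induct)
  case (less n)
  show ?case
  proof (cases "n = 0")
    case False
    then show ?thesis
      using less assms by (subst arch_path_rec) (auto intro!: mult_nonneg_nonneg add_nonneg_nonneg sum_nonneg)
  qed (simp add: assms)
qed

text \<open>
  The volatility caused by a unit impulse at time 0, that is, the impulse response before it is
  multiplied by the current innovation; it depends on the innovations at times \<open>1, \<dots>, n - 1\<close> only.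
\<close>
definition arch_kick :: "(nat \<Rightarrow> real) \<Rightarrow> (nat \<Rightarrow> real) \<Rightarrow> nat \<Rightarrow> real" where
  "arch_kick b x n = (\<Sum>j<n. b (n - j) * arch_path 1 0 b x j)"

lemma arch_path_kick: "0 < n \<Longrightarrow> arch_path 1 0 b x n = x n * arch_kick b x n"
  by (simp add: arch_path_rec arch_kick_def)

text \<open>
  Writing \<open>x i = l + (x i - l)\<close> turns the random linear recursion into the deterministic one with multiplier
  \<open>l\<close>, driven by the terms \<open>(x i - l) * arch_kick b x i\<close>; its resolvent is \<open>arch_z\<close>. When the \<open>x i\<close> are
  independent with mean \<open>l\<close>, the summands are orthogonal.
\<close>
lemma arch_kick_decomposition:
  "0 < n \<Longrightarrow> l * arch_kick b x n
     = arch_z l b n + (\<Sum>i\<in>{1..<n}. arch_z l b (n - i) * ((x i - l) * arch_kick b x i))"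
proof (induction n rule: less_induct)
  case (less n)
  \<comment> \<open>the initial impulse counts as the driving term at time 0\<close>
  define \<nu> where "\<nu> i = (if i = 0 then 1 else (x i - l) * arch_kick b x i)" for i
  have all: "(\<Sum>i<m. arch_z l b (m - i) * \<nu> i)
      = arch_z l b m + (\<Sum>i\<in>{1..<m}. arch_z l b (m - i) * ((x i - l) * arch_kick b x i))" if "0 < m" for m
  proof -
    have "{..<m} = insert 0 {1..<m}" using that by auto
    then show ?thesis by (auto simp: \<nu>_def intro!: sum.cong)
  qed
  have path: "arch_path 1 0 b x j = (\<Sum>i\<le>j. arch_z l b (j - i) * \<nu> i)" if "j < n" for j
  proof (cases "j = 0")
    case False
    have "arch_path 1 0 b x j = l * arch_kick b x j + \<nu> j"
      using False by (simp add: arch_path_kick \<nu>_def algebra_simps)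
    also have "l * arch_kick b x j = (\<Sum>i<j. arch_z l b (j - i) * \<nu> i)"
      using less.IH[OF that] False by (simp add: all)
    finally show ?thesis by (simp flip: lessThan_Suc_atMost)
  qed (simp add: \<nu>_def)
  have "l * arch_kick b x n = (\<Sum>j<n. \<Sum>i\<le>j. l * (b (n - j) * arch_z l b (j - i)) * \<nu> i)"
    unfolding arch_kick_def by (simp add: path sum_distrib_left mult_ac)
  also have "\<dots> = (\<Sum>i<n. \<Sum>j<n - i. l * (b (n - i - j) * arch_z l b j) * \<nu> i)"
    by (subst sum.Sigma, simp, simp, subst sum.Sigma, simp, simp,
        rule sum.reindex_bij_witness[of _ "\<lambda>(i,s). (i + s,i)" "\<lambda>(t,i). (i,t - i)"]) auto
  also have "\<dots> = (\<Sum>i<n. arch_z l b (n - i) * \<nu> i)"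
    by (intro sum.cong refl) (auto simp: arch_z_rec sum_distrib_left sum_distrib_right)
  finally show ?case using all less.prems by simp
qed

section \<open>Innovations and their history\<close>

locale iid_innovations = prob_space M for M :: "'w measure" +
  fixes \<xi> :: "int \<Rightarrow> 'w \<Rightarrow> real"
  assumes iid: "iid M \<xi>"
    and integrable_0: "integrable M (\<xi> 0)"
    and integrable_sq_0: "integrable M (\<lambda>\<omega>. (\<xi> 0 \<omega>)\<^sup>2)"
begin

definition "lam1 = expectation (\<xi> 0)"
definition "lam2 = expectation (\<lambda>\<omega>. (\<xi> 0 \<omega>)\<^sup>2)"
definition "sig2 = lam2 - lam1\<^sup>2"

lemma indep: "indep_vars (\<lambda>_. borel) \<xi> UNIV"
  using iid unfolding iid_def by blast

lemma measurable_innovation [measurable]: "\<xi> k \<in> borel_measurable M"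
  using indep by (simp add: indep_vars_def)

lemma same_distribution: "distr M borel (\<xi> k) = distr M borel (\<xi> 0)"
  by (rule iid[unfolded iid_def, THEN conjunct2, rule_format])

lemma innovation_transfer:
  assumes [measurable]: "\<phi> \<in> borel_measurable borel"
  shows "integrable M (\<lambda>\<omega>. \<phi> (\<xi> k \<omega>) :: real) \<longleftrightarrow> integrable M (\<lambda>\<omega>. \<phi> (\<xi> 0 \<omega>))"
    and "expectation (\<lambda>\<omega>. \<phi> (\<xi> k \<omega>)) = expectation (\<lambda>\<omega>. \<phi> (\<xi> 0 \<omega>))"
proof -
  show "integrable M (\<lambda>\<omega>. \<phi> (\<xi> k \<omega>)) \<longleftrightarrow> integrable M (\<lambda>\<omega>. \<phi> (\<xi> 0 \<omega>))"
    using integrable_distr_eq[of "\<xi> k" M borel \<phi>] integrable_distr_eq[of "\<xi> 0" M borel \<phi>]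
    unfolding same_distribution[of k] by simp
  show "expectation (\<lambda>\<omega>. \<phi> (\<xi> k \<omega>)) = expectation (\<lambda>\<omega>. \<phi> (\<xi> 0 \<omega>))"
    using integral_distr[of "\<xi> k" M borel \<phi>] integral_distr[of "\<xi> 0" M borel \<phi>]
    unfolding same_distribution[of k] by simp
qed

lemma innovation_moments [simp]:
  "integrable M (\<xi> k)" "expectation (\<xi> k) = lam1"
  "integrable M (\<lambda>\<omega>. (\<xi> k \<omega>)\<^sup>2)" "expectation (\<lambda>\<omega>. (\<xi> k \<omega>)\<^sup>2) = lam2"
  using innovation_transfer[of "\<lambda>x. x" k] innovation_transfer[of "\<lambda>x. x\<^sup>2" k]
    integrable_0 integrable_sq_0 by (simp_all add: lam1_def lam2_def)

lemma centred_innovation_moments [simp]: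
  "integrable M (\<lambda>\<omega>. \<xi> k \<omega> - lam1)" "expectation (\<lambda>\<omega>. \<xi> k \<omega> - lam1) = 0"
  "integrable M (\<lambda>\<omega>. (\<xi> k \<omega> - lam1)\<^sup>2)" "expectation (\<lambda>\<omega>. (\<xi> k \<omega> - lam1)\<^sup>2) = sig2"
proof -
  show "integrable M (\<lambda>\<omega>. \<xi> k \<omega> - lam1)" "expectation (\<lambda>\<omega>. \<xi> k \<omega> - lam1) = 0"
    by (simp_all add: prob_space)
  show "integrable M (\<lambda>\<omega>. (\<xi> k \<omega> - lam1)\<^sup>2)" "expectation (\<lambda>\<omega>. (\<xi> k \<omega> - lam1)\<^sup>2) = sig2"
    by (simp_all add: power2_diff prob_space sig2_def power2_eq_square[of lam1])
qed

text \<open>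
  Generated by the vector of the past innovations, so that independence of disjoint subfamilies
  of \<open>\<xi>\<close> translates into independence of \<open>\<xi> k\<close> from \<open>history k\<close>.
\<close>
definition history :: "int \<Rightarrow> 'w measure" where
  "history k = vimage_algebra (space M) (\<lambda>\<omega>. \<lambda>i\<in>{..<k}. \<xi> i \<omega>) (PiM {..<k} (\<lambda>_. borel))"

lemma space_history [simp]: "space (history k) = space M"
  by (simp add: history_def)

lemma measurable_history_innovation:
  assumes "i < k"
  shows "\<xi> i \<in> borel_measurable (history k)"
proof -
  have "(\<lambda>\<omega>. \<lambda>i\<in>{..<k}. \<xi> i \<omega>) \<in> measurable (history k) (PiM {..<k} (\<lambda>_. borel))"
    unfolding history_def by (rule measurable_vimage_algebra1) (auto simp: space_PiM)
  then have "(\<lambda>\<omega>. (\<lambda>i\<in>{..<k}. \<xi> i \<omega>) i) \<in> borel_measurable (history k)"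
    by (rule measurable_compose[OF _ measurable_component_singleton]) (use assms in auto)
  then show ?thesis using assms by simp
qed

lemma measurable_historyD:
  assumes "Y \<in> measurable (history k) N"
  shows "Y \<in> measurable M N"
proof -
  have "sets (history k) \<subseteq> sets M"
    unfolding history_def by (rule sets_image_in_sets) auto
  then show ?thesis
    using assms by (auto simp: measurable_def)
qed

lemma measurable_history_mono:
  assumes "Y \<in> measurable (history k) N" "k \<le> m"
  shows "Y \<in> measurable (history m) N"
proof -
  have "sets (history k) \<subseteq> sets (history m)"
    unfolding history_def[of k]
    by (rule sets_image_in_sets)
      (use assms(2) in \<open>auto intro!: measurable_restrict measurable_history_innovation\<close>)
  then show ?thesis
    using assms by (auto simp: measurable_def)
qed

text \<open>
  The preimage sigma-algebra of \<open>\<xi> k\<close> lies in that of the one-coordinate family, the one of \<open>Y\<close> in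
  \<open>history k\<close>, and disjoint subfamilies of an independent family are independent.
\<close>
lemma indep_var_history:
  assumes Y: "Y \<in> measurable (history k) N"
  shows "indep_var borel (\<xi> k) N Y"
proof -
  let ?h = "\<lambda>\<omega>. \<lambda>i\<in>{..<k}. \<xi> i \<omega>"
  have "indep_var (PiM {k} (\<lambda>_. borel)) (\<lambda>\<omega>. \<lambda>i\<in>{k}. \<xi> i \<omega>) (PiM {..<k} (\<lambda>_. borel)) ?h"
    by (rule indep_var_restrict[OF indep]) auto
  then have ind: "indep_set
      (sigma_sets (space M) {(\<lambda>\<omega>. \<lambda>i\<in>{k}. \<xi> i \<omega>) -` A \<inter> space M |A. A \<in> sets (PiM {k} (\<lambda>_. borel))})
      (sigma_sets (space M) {?h -` A \<inter> space M |A. A \<in> sets (PiM {..<k} (\<lambda>_. borel))})"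
    by (simp add: indep_var_eq)
  have hist: "sigma_sets (space M) {?h -` A \<inter> space M |A. A \<in> sets (PiM {..<k} (\<lambda>_. borel))} = sets (history k)"
    by (simp add: history_def sets_vimage_algebra)
  have A: "sigma_sets (space M) {\<xi> k -` A \<inter> space M |A. A \<in> sets borel}
     \<subseteq> sigma_sets (space M) {(\<lambda>\<omega>. \<lambda>i\<in>{k}. \<xi> i \<omega>) -` A \<inter> space M |A. A \<in> sets (PiM {k} (\<lambda>_. borel))}"
  proof (rule sigma_sets_mono', rule subsetI)
    fix C assume "C \<in> {\<xi> k -` A \<inter> space M |A. A \<in> sets borel}"
    then obtain A where A: "A \<in> sets borel" "C = \<xi> k -` A \<inter> space M" by auto
    let ?A = "(\<lambda>f. f k) -` A \<inter> space (PiM {k} (\<lambda>_. borel :: real measure))"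
    have "?A \<in> sets (PiM {k} (\<lambda>_. borel))"
      by (rule measurable_sets[OF _ A(1)]) simp
    moreover have "C = (\<lambda>\<omega>. \<lambda>i\<in>{k}. \<xi> i \<omega>) -` ?A \<inter> space M"
      unfolding A(2) by (auto simp: space_PiM)
    ultimately show "C \<in> {(\<lambda>\<omega>. \<lambda>i\<in>{k}. \<xi> i \<omega>) -` A \<inter> space M |A. A \<in> sets (PiM {k} (\<lambda>_. borel))}"
      by (intro CollectI exI conjI)
  qed
  have B: "sigma_sets (space M) {Y -` A \<inter> space M |A. A \<in> sets N} \<subseteq> sets (history k)"
  proof -
    have "{Y -` A \<inter> space M |A. A \<in> sets N} \<subseteq> sets (history k)"
      using measurable_sets[OF Y] by auto
    from sets.sigma_sets_subset[OF this] show ?thesis by simp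
  qed
  show ?thesis
    unfolding indep_var_eq
  proof (intro conjI)
    show "indep_set (sigma_sets (space M) {\<xi> k -` A \<inter> space M |A. A \<in> sets borel})
        (sigma_sets (space M) {Y -` A \<inter> space M |A. A \<in> sets N})"
      using ind unfolding hist indep_sets2_eq using A B by (meson subset_eq)
  qed (use measurable_historyD[OF Y] in auto)
qed

lemma expectation_innovation_history:
  fixes \<phi> :: "real \<Rightarrow> real"
  assumes [measurable]: "\<phi> \<in> borel_measurable borel" and \<phi>: "integrable M (\<lambda>\<omega>. \<phi> (\<xi> k \<omega>))"
    and Y: "Y \<in> borel_measurable (history k)" "integrable M Y"
  shows "integrable M (\<lambda>\<omega>. \<phi> (\<xi> k \<omega>) * Y \<omega>)"
    and "expectation (\<lambda>\<omega>. \<phi> (\<xi> k \<omega>) * Y \<omega>) = expectation (\<lambda>\<omega>. \<phi> (\<xi> k \<omega>)) * expectation Y"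
proof -
  have "indep_var borel (\<phi> \<circ> \<xi> k) borel ((\<lambda>y. y) \<circ> Y)"
    using indep_var_history[OF Y(1)] by (rule indep_var_compose) auto
  then have ind: "indep_var borel (\<lambda>\<omega>. \<phi> (\<xi> k \<omega>)) borel Y" by (simp add: o_def)
  show "integrable M (\<lambda>\<omega>. \<phi> (\<xi> k \<omega>) * Y \<omega>)"
    by (rule indep_var_integrable[OF ind \<phi> Y(2)])
  show "expectation (\<lambda>\<omega>. \<phi> (\<xi> k \<omega>) * Y \<omega>) = expectation (\<lambda>\<omega>. \<phi> (\<xi> k \<omega>)) * expectation Y"
    by (rule indep_var_lebesgue_integral[OF ind \<phi> Y(2)])
qed

end

section \<open>Second moments of the impulse response\<close>

lemma L2_product:
  fixes U W :: "'w \<Rightarrow> real"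
  assumes [measurable]: "U \<in> borel_measurable M" "W \<in> borel_measurable M"
    and U: "integrable M (\<lambda>\<omega>. (U \<omega>)\<^sup>2)" and W: "integrable M (\<lambda>\<omega>. (W \<omega>)\<^sup>2)"
  shows "integrable M (\<lambda>\<omega>. U \<omega> * W \<omega>)"
    and "(\<integral>\<omega>. \<bar>U \<omega> * W \<omega>\<bar> \<partial>M) \<le> sqrt (\<integral>\<omega>. (U \<omega>)\<^sup>2 \<partial>M) * sqrt (\<integral>\<omega>. (W \<omega>)\<^sup>2 \<partial>M)"
proof -
  have le: "\<bar>U \<omega> * W \<omega>\<bar> \<le> ((U \<omega>)\<^sup>2 + (W \<omega>)\<^sup>2) / 2" for \<omega>
    using sum_squares_bound[of "\<bar>U \<omega>\<bar>" "\<bar>W \<omega>\<bar>"] by (simp add: abs_mult)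
  have int: "integrable M (\<lambda>\<omega>. ((U \<omega>)\<^sup>2 + (W \<omega>)\<^sup>2) / 2)"
    using U W by simp
  show *: "integrable M (\<lambda>\<omega>. U \<omega> * W \<omega>)"
    by (rule Bochner_Integration.integrable_bound[OF int]) (use le in \<open>auto intro: order_trans\<close>)
  have "ennreal ((\<integral>\<omega>. \<bar>U \<omega> * W \<omega>\<bar> \<partial>M)\<^sup>2) = (\<integral>\<^sup>+\<omega>. ennreal \<bar>U \<omega> * W \<omega>\<bar> \<partial>M)\<^sup>2"
    using * by (subst nn_integral_eq_integral) (auto simp: ennreal_power)
  also have "\<dots> \<le> (\<integral>\<^sup>+\<omega>. ennreal ((U \<omega>)\<^sup>2) \<partial>M) * (\<integral>\<^sup>+\<omega>. ennreal ((W \<omega>)\<^sup>2) \<partial>M)"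
    using Cauchy_Schwarz_nn_integral[of "\<lambda>\<omega>. ennreal \<bar>U \<omega>\<bar>" M "\<lambda>\<omega>. ennreal \<bar>W \<omega>\<bar>"]
    by (simp add: abs_mult ennreal_mult ennreal_power)
  also have "\<dots> = ennreal ((\<integral>\<omega>. (U \<omega>)\<^sup>2 \<partial>M) * (\<integral>\<omega>. (W \<omega>)\<^sup>2 \<partial>M))"
    using U W by (simp add: nn_integral_eq_integral ennreal_mult)
  finally have "(\<integral>\<omega>. \<bar>U \<omega> * W \<omega>\<bar> \<partial>M)\<^sup>2 \<le> (\<integral>\<omega>. (U \<omega>)\<^sup>2 \<partial>M) * (\<integral>\<omega>. (W \<omega>)\<^sup>2 \<partial>M)"
    by (simp add: ennreal_le_iff)
  then show "(\<integral>\<omega>. \<bar>U \<omega> * W \<omega>\<bar> \<partial>M) \<le> sqrt (\<integral>\<omega>. (U \<omega>)\<^sup>2 \<partial>M) * sqrt (\<integral>\<omega>. (W \<omega>)\<^sup>2 \<partial>M)"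
    unfolding real_sqrt_mult[symmetric] by (rule real_le_rsqrt)
qed

context iid_innovations
begin

lemma second_moment_innovation:
  assumes W: "W \<in> borel_measurable (history k)" "integrable M (\<lambda>\<omega>. (W \<omega>)\<^sup>2)"
  shows "integrable M (\<lambda>\<omega>. (\<xi> k \<omega> * W \<omega>)\<^sup>2)"
    and "expectation (\<lambda>\<omega>. (\<xi> k \<omega> * W \<omega>)\<^sup>2) = lam2 * expectation (\<lambda>\<omega>. (W \<omega>)\<^sup>2)"
  using expectation_innovation_history[of "\<lambda>x. x\<^sup>2" k "\<lambda>\<omega>. (W \<omega>)\<^sup>2"] W
  by (auto simp: power_mult_distrib)

text \<open>
  Pythagoras: a centred innovation times a past variable is orthogonal to every past variable.
\<close>
lemma second_moment_innovation_step:
  assumes U: "U \<in> borel_measurable (history k)" "integrable M (\<lambda>\<omega>. (U \<omega>)\<^sup>2)"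
    and W: "W \<in> borel_measurable (history k)" "integrable M (\<lambda>\<omega>. (W \<omega>)\<^sup>2)"
  shows "integrable M (\<lambda>\<omega>. (U \<omega> + (\<xi> k \<omega> - lam1) * W \<omega>)\<^sup>2)"
    and "expectation (\<lambda>\<omega>. (U \<omega> + (\<xi> k \<omega> - lam1) * W \<omega>)\<^sup>2)
           = expectation (\<lambda>\<omega>. (U \<omega>)\<^sup>2) + sig2 * expectation (\<lambda>\<omega>. (W \<omega>)\<^sup>2)"
proof -
  note [measurable] = measurable_historyD[OF U(1)] measurable_historyD[OF W(1)]
  have UW: "integrable M (\<lambda>\<omega>. U \<omega> * W \<omega>)"
    by (rule L2_product) (auto simp: U W)
  note cross = expectation_innovation_history[of "\<lambda>x. x - lam1" k "\<lambda>\<omega>. U \<omega> * W \<omega>"]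
  note sq = expectation_innovation_history[of "\<lambda>x. (x - lam1)\<^sup>2" k "\<lambda>\<omega>. (W \<omega>)\<^sup>2"]
  have cross': "integrable M (\<lambda>\<omega>. (\<xi> k \<omega> - lam1) * (U \<omega> * W \<omega>))"
      "expectation (\<lambda>\<omega>. (\<xi> k \<omega> - lam1) * (U \<omega> * W \<omega>)) = 0"
    using cross U W UW by auto
  have sq': "integrable M (\<lambda>\<omega>. (\<xi> k \<omega> - lam1)\<^sup>2 * (W \<omega>)\<^sup>2)"
      "expectation (\<lambda>\<omega>. (\<xi> k \<omega> - lam1)\<^sup>2 * (W \<omega>)\<^sup>2) = sig2 * expectation (\<lambda>\<omega>. (W \<omega>)\<^sup>2)"
    using sq W by auto
  have eq: "(\<lambda>\<omega>. (U \<omega> + (\<xi> k \<omega> - lam1) * W \<omega>)\<^sup>2)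
      = (\<lambda>\<omega>. (U \<omega>)\<^sup>2 + 2 * ((\<xi> k \<omega> - lam1) * (U \<omega> * W \<omega>)) + (\<xi> k \<omega> - lam1)\<^sup>2 * (W \<omega>)\<^sup>2)"
    by (auto simp: power2_eq_square algebra_simps)
  show "integrable M (\<lambda>\<omega>. (U \<omega> + (\<xi> k \<omega> - lam1) * W \<omega>)\<^sup>2)"
    unfolding eq
    by (intro Bochner_Integration.integrable_add integrable_mult_right cross'(1) sq'(1) U(2))
  show "expectation (\<lambda>\<omega>. (U \<omega> + (\<xi> k \<omega> - lam1) * W \<omega>)\<^sup>2)
           = expectation (\<lambda>\<omega>. (U \<omega>)\<^sup>2) + sig2 * expectation (\<lambda>\<omega>. (W \<omega>)\<^sup>2)"
    unfolding eq
    by (subst Bochner_Integration.integral_add Bochner_Integration.integral_mult_right,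
        (intro Bochner_Integration.integrable_add integrable_mult_right cross'(1) sq'(1) U(2))+)+
      (simp add: cross'(2) sq'(2))
qed

abbreviation \<xi>_from :: "int \<Rightarrow> 'w \<Rightarrow> nat \<Rightarrow> real" where
  "\<xi>_from l \<omega> \<equiv> \<lambda>i. \<xi> (l + int i) \<omega>"

lemma measurable_history_arch_path:
  "l + int n < k \<Longrightarrow> (\<lambda>\<omega>. arch_path y0 a b (\<xi>_from l \<omega>) n) \<in> borel_measurable (history k)"
  by (rule measurable_arch_path) (auto intro: measurable_history_innovation)

lemma measurable_history_arch_kick:
  "(\<lambda>\<omega>. arch_kick b (\<xi>_from l \<omega>) n) \<in> borel_measurable (history (l + int n))"
  unfolding arch_kick_def
  by (intro borel_measurable_sum borel_measurable_times borel_measurable_const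
      measurable_history_arch_path) auto

text \<open>
  The decomposition of \<open>arch_kick\<close> along \<open>z\<close>, evaluated by adding its orthogonal terms one time step after
  the other. Multiplied by \<open>sig2 / lam1\<^sup>2\<close>, the identity is a renewal equation for \<open>sig2\<close> times the second
  moments of \<open>arch_kick\<close>.
\<close>
lemma arch_kick_second_moment:
  assumes lam1: "lam1 \<noteq> 0" and n: "0 < n"
  shows "integrable M (\<lambda>\<omega>. (arch_kick b (\<xi>_from l \<omega>) n)\<^sup>2)"
    and "lam1\<^sup>2 * expectation (\<lambda>\<omega>. (arch_kick b (\<xi>_from l \<omega>) n)\<^sup>2)
       = (arch_z lam1 b n)\<^sup>2 + (\<Sum>i\<in>{1..<n}. (arch_z lam1 b (n - i))\<^sup>2 *
           (sig2 * expectation (\<lambda>\<omega>. (arch_kick b (\<xi>_from l \<omega>) i)\<^sup>2)))"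
proof -
  let ?q = "\<lambda>i \<omega>. arch_kick b (\<xi>_from l \<omega>) i" and ?z = "arch_z lam1 b"
  have "integrable M (\<lambda>\<omega>. (?q n \<omega>)\<^sup>2) \<and> lam1\<^sup>2 * expectation (\<lambda>\<omega>. (?q n \<omega>)\<^sup>2)
       = (?z n)\<^sup>2 + (\<Sum>i\<in>{1..<n}. (?z (n - i))\<^sup>2 * (sig2 * expectation (\<lambda>\<omega>. (?q i \<omega>)\<^sup>2)))"
    using n
  proof (induction n rule: less_induct)
    case (less n)
    define S where "S m \<omega> = ?z n + (\<Sum>i\<in>{1..<m}. ?z (n - i) * ((\<xi> (l + int i) \<omega> - lam1) * ?q i \<omega>))"
      for m \<omega>
    have S: "S m \<in> borel_measurable (history (l + int m)) \<and> integrable M (\<lambda>\<omega>. (S m \<omega>)\<^sup>2)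
        \<and> expectation (\<lambda>\<omega>. (S m \<omega>)\<^sup>2)
          = (?z n)\<^sup>2 + (\<Sum>i\<in>{1..<m}. (?z (n - i))\<^sup>2 * (sig2 * expectation (\<lambda>\<omega>. (?q i \<omega>)\<^sup>2)))"
      if "1 \<le> m" "m \<le> n" for m
      using that
    proof (induction m rule: dec_induct)
      case base
      then show ?case by (simp add: S_def prob_space)
    next
      case (step m)
      then have IH: "S m \<in> borel_measurable (history (l + int m))" "integrable M (\<lambda>\<omega>. (S m \<omega>)\<^sup>2)"
        "expectation (\<lambda>\<omega>. (S m \<omega>)\<^sup>2)
          = (?z n)\<^sup>2 + (\<Sum>i\<in>{1..<m}. (?z (n - i))\<^sup>2 * (sig2 * expectation (\<lambda>\<omega>. (?q i \<omega>)\<^sup>2)))"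
        by auto
      have q: "integrable M (\<lambda>\<omega>. (?q m \<omega>)\<^sup>2)"
        using less.IH[of m] step by auto
      have S_Suc: "S (Suc m) = (\<lambda>\<omega>. S m \<omega> + (\<xi> (l + int m) \<omega> - lam1) * (?z (n - m) * ?q m \<omega>))"
        using step by (auto simp: S_def fun_eq_iff)
      have W: "(\<lambda>\<omega>. ?z (n - m) * ?q m \<omega>) \<in> borel_measurable (history (l + int m))"
          "integrable M (\<lambda>\<omega>. (?z (n - m) * ?q m \<omega>)\<^sup>2)"
        using measurable_history_arch_kick q by (auto simp: power_mult_distrib)
      have meas: "S (Suc m) \<in> borel_measurable (history (l + int (Suc m)))"
        unfolding S_Suc
        by (intro borel_measurable_add borel_measurable_times borel_measurable_diff
            borel_measurable_const measurable_history_innovation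
            measurable_history_mono[OF IH(1)] measurable_history_mono[OF measurable_history_arch_kick])
          auto
      from second_moment_innovation_step[OF IH(1,2) W] step meas IH(3)
      show ?case by (simp add: S_Suc power_mult_distrib mult_ac)
    qed
    have "(\<lambda>\<omega>. lam1\<^sup>2 * (?q n \<omega>)\<^sup>2) = (\<lambda>\<omega>. (S n \<omega>)\<^sup>2)"
      unfolding power_mult_distrib[symmetric] S_def
      by (subst arch_kick_decomposition[OF less.prems, of lam1]) simp
    then have *: "integrable M (\<lambda>\<omega>. lam1\<^sup>2 * (?q n \<omega>)\<^sup>2)"
        "expectation (\<lambda>\<omega>. lam1\<^sup>2 * (?q n \<omega>)\<^sup>2)
          = (?z n)\<^sup>2 + (\<Sum>i\<in>{1..<n}. (?z (n - i))\<^sup>2 * (sig2 * expectation (\<lambda>\<omega>. (?q i \<omega>)\<^sup>2)))"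
      using S[of n] less.prems by auto
    then show ?case using lam1 by simp
  qed
  then show "integrable M (\<lambda>\<omega>. (?q n \<omega>)\<^sup>2)"
    "lam1\<^sup>2 * expectation (\<lambda>\<omega>. (?q n \<omega>)\<^sup>2)
       = (?z n)\<^sup>2 + (\<Sum>i\<in>{1..<n}. (?z (n - i))\<^sup>2 * (sig2 * expectation (\<lambda>\<omega>. (?q i \<omega>)\<^sup>2)))"
    by auto
qed

end

lemma summable_power2_of_summable:
  fixes z :: "nat \<Rightarrow> real"
  assumes "summable z" "\<And>n. z n \<ge> 0"
  shows "summable (\<lambda>n. (z n)\<^sup>2)"
proof (rule summable_comparison_test')
  show "summable (\<lambda>n. suminf z * z n)" using assms by (simp add: summable_mult)
  fix n :: nat assume "0 \<le> n"
  have "z n \<le> suminf z"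
    using sum_le_suminf[OF assms(1), of "{n}"] assms(2) by simp
  then show "norm ((z n)\<^sup>2) \<le> suminf z * z n"
    using assms(2)[of n] by (simp add: power2_eq_square mult_right_mono)
qed

text \<open>
  The assumption \<open>second_order\<close> is \<open>\<Omega>\<^sup>2 < 1\<close> multiplied by \<open>lam1\<^sup>2\<close>.
\<close>
locale arch_data = iid_innovations M \<xi> for M :: "'w measure" and \<xi> +
  fixes b :: "nat \<Rightarrow> real"
  assumes b_nonneg: "\<And>j. j \<ge> 1 \<Longrightarrow> b j \<ge> 0"
    and summable_b: "summable (\<lambda>j. b (Suc j))"
    and lam1_pos: "lam1 > 0"
    and sig2_pos: "sig2 > 0"
    and first_order: "lam1 * (\<Sum>j. b (Suc j)) < 1"
    and second_order: "sig2 * (\<Sum>j. (arch_z lam1 b (Suc j))\<^sup>2) < lam1\<^sup>2"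
begin

abbreviation "B \<equiv> \<Sum>j. b (Suc j)"
abbreviation "z \<equiv> arch_z lam1 b"

lemma z_nonneg: "z n \<ge> 0"
  using arch_z_nonneg[of lam1 b] lam1_pos b_nonneg by simp

lemma summable_z: "summable z"
  using summable_arch_z[of lam1 b] lam1_pos b_nonneg summable_b first_order by simp

lemma summable_z2: "summable (\<lambda>n. (z n)\<^sup>2)"
  by (rule summable_power2_of_summable[OF summable_z z_nonneg])

lemma sum_z2: "(\<Sum>n. (z n)\<^sup>2) = 1 + (\<Sum>n. (z (Suc n))\<^sup>2)"
  using suminf_split_head[OF summable_z2] by simp

text \<open>
  The recursion for the second moments does not mention the starting time.
\<close>
lemma kick_second_moment_shift:
  "expectation (\<lambda>\<omega>. (arch_kick b (\<xi>_from l \<omega>) n)\<^sup>2) = expectation (\<lambda>\<omega>. (arch_kick b (\<xi>_from 0 \<omega>) n)\<^sup>2)"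
proof (induction n rule: less_induct)
  case (less n)
  show ?case
  proof (cases "n = 0")
    case False
    then have "lam1\<^sup>2 * expectation (\<lambda>\<omega>. (arch_kick b (\<xi>_from l \<omega>) n)\<^sup>2)
        = lam1\<^sup>2 * expectation (\<lambda>\<omega>. (arch_kick b (\<xi>_from 0 \<omega>) n)\<^sup>2)"
      using lam1_pos arch_kick_second_moment(2)[of n b l] arch_kick_second_moment(2)[of n b 0] less by simp
    then show ?thesis using lam1_pos by simp
  qed (simp add: arch_kick_def)
qed

text \<open>
  The kernel of the renewal equation is \<open>sig2 / lam1\<^sup>2 * (z n)\<^sup>2\<close>: its mass over \<open>n \<ge> 1\<close> is below 1 by
  \<open>second_order\<close>, and its square roots are summable because \<open>z\<close> is.
\<close>
lemma summable_kick_norm: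
  "summable (\<lambda>n. sqrt (expectation (\<lambda>\<omega>. (arch_kick b (\<xi>_from 0 \<omega>) n)\<^sup>2)))"
proof -
  let ?E = "\<lambda>n. expectation (\<lambda>\<omega>. (arch_kick b (\<xi>_from 0 \<omega>) n)\<^sup>2)"
  define s where "s = sig2 / lam1\<^sup>2"
  define f where "f n = (if n = 0 then 0 else s * (z n)\<^sup>2)" for n
  have s: "s > 0" using sig2_pos lam1_pos by (simp add: s_def)
  have E0: "?E 0 = 0" by (simp add: arch_kick_def)
  note E0' = E0[simplified]
  have f_le: "f n \<le> s * (z n)\<^sup>2" for n using s by (simp add: f_def)
  have f_Suc: "f (Suc n) = s * (z (Suc n))\<^sup>2" for n by (simp add: f_def)
  have sf: "summable f"
    by (rule summable_comparison_test'[where g = "\<lambda>n. s * (z n)\<^sup>2"])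
      (use s in \<open>auto simp: f_def summable_mult summable_z2\<close>)
  have renewal: "sig2 * ?E n = f n + (\<Sum>i\<le>n. f i * (sig2 * ?E (n - i)))" for n
  proof (cases "n = 0")
    case False
    have "sig2 * ?E n = s * (lam1\<^sup>2 * ?E n)"
      using lam1_pos by (simp add: s_def)
    also have "\<dots> = f n + (\<Sum>i\<in>{1..<n}. f (n - i) * (sig2 * ?E i))"
      using False lam1_pos arch_kick_second_moment(2)[of n b 0]
      by (simp add: f_def distrib_left sum_distrib_left mult.assoc)
    also have "(\<Sum>i\<in>{1..<n}. f (n - i) * (sig2 * ?E i)) = (\<Sum>i\<in>{1..<n}. f i * (sig2 * ?E (n - i)))"
      by (rule sum.reindex_bij_witness[of _ "\<lambda>i. n - i" "\<lambda>i. n - i"]) auto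
    also have "\<dots> = (\<Sum>i\<le>n. f i * (sig2 * ?E (n - i)))"
      by (rule sum.mono_neutral_left) (auto simp: f_def E0')
    finally show ?thesis .
  qed (simp add: E0' f_def)
  have "summable (\<lambda>n. sqrt (sig2 * ?E n))"
  proof (rule summable_sqrt_renewal[OF _ _ _ _ renewal])
    show "summable (\<lambda>n. sqrt (f n))"
    proof (rule summable_comparison_test'[where g = "\<lambda>n. sqrt s * z n"])
      fix n :: nat
      have "sqrt (f n) \<le> sqrt (s * (z n)\<^sup>2)" using f_le by simp
      then show "norm (sqrt (f n)) \<le> sqrt s * z n"
        using s z_nonneg[of n] by (auto simp: f_def real_sqrt_mult)
    qed (simp add: summable_mult summable_z)
    have "(\<Sum>n. f n) = (\<Sum>n. s * (z (Suc n))\<^sup>2)"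
      using suminf_split_head[OF sf] by (simp add: f_Suc) (simp add: f_def)
    also have "\<dots> = s * (\<Sum>n. (z (Suc n))\<^sup>2)"
      using summable_z2 by (intro suminf_mult) (subst summable_Suc_iff)
    also have "\<dots> < 1" using second_order lam1_pos by (simp add: s_def field_simps)
    finally show "(\<Sum>n. f n) < 1" .
    show "summable f" by (rule sf)
  qed (use s sig2_pos E0' in \<open>auto simp: f_def\<close>)
  then have "summable (\<lambda>n. sqrt (sig2 * ?E n) / sqrt sig2)"
    by (rule summable_divide)
  then show ?thesis using sig2_pos by (simp add: real_sqrt_mult)
qed

end

section \<open>Causality of solutions with bounded second moments\<close>

text \<open>
  The error at time \<open>m + n\<close> is bounded by the responses to the values of \<open>X\<close> up to time \<open>m\<close>, which the
  truncated recursion replaces by 0. The error obeys the homogeneous recursion (with an inequality), and so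
  does each impulse response; hence induction on \<open>n\<close>.
\<close>
lemma arch_path_error:
  fixes X x :: "int \<Rightarrow> real"
  assumes x: "\<And>k. x k \<ge> 0" and b: "\<And>j. j \<ge> 1 \<Longrightarrow> b j \<ge> 0"
    and abs_summable: "\<And>k. summable (\<lambda>j. b (Suc j) * \<bar>X (k - int (Suc j))\<bar>)"
    and eq: "\<And>k. X k = (a + (\<Sum>j. b (Suc j) * X (k - int (Suc j)))) * x k"
  shows "ennreal \<bar>X (m + int n) - arch_path 0 a b (\<lambda>i. x (m + int i)) n\<bar>
     \<le> (\<Sum>r. ennreal (arch_path 1 0 b (\<lambda>i. x (m - int r + int i)) (n + r) * \<bar>X (m - int r)\<bar>))"
proof (induction n rule: less_induct)
  case (less n)
  let ?y = "arch_path 0 a b (\<lambda>i. x (m + int i))"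
  let ?g = "\<lambda>r. arch_path 1 0 b (\<lambda>i. x (m - int r + int i))"
  have g: "?g r j \<ge> 0" for r j
    using x b by (intro arch_path_nonneg) auto
  show ?case
  proof (cases "n = 0")
    case True
    have "ennreal \<bar>X m\<bar> = (\<Sum>r\<in>{0}. ennreal (?g r r * \<bar>X (m - int r)\<bar>))" by simp
    also have "\<dots> \<le> (\<Sum>r. ennreal (?g r r * \<bar>X (m - int r)\<bar>))"
      by (rule sum_le_suminf) auto
    finally show ?thesis using True by simp
  next
    case False
    \<comment> \<open>the part of the series in \<open>X (m + int n)\<close> that reaches back to time \<open>m\<close> or further\<close>
    define T where "T = (\<Sum>r. b (n + r) * X (m - int r))"
    define T' where "T' = (\<Sum>r. b (n + r) * \<bar>X (m - int r)\<bar>)"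
    have sT': "summable (\<lambda>r. b (n + r) * \<bar>X (m - int r)\<bar>)"
      using summable_ignore_initial_segment[OF abs_summable[of "m + int n"], of "n - 1"] False
      by (simp add: algebra_simps of_nat_diff)
    have T: "\<bar>T\<bar> \<le> T'"
    proof -
      have eq': "\<bar>b (n + r) * X (m - int r)\<bar> = b (n + r) * \<bar>X (m - int r)\<bar>" for r
        using b[of "n + r"] False by (simp add: abs_mult)
      show ?thesis
        using summable_rabs[of "\<lambda>r. b (n + r) * X (m - int r)"] sT'
        unfolding T_def T'_def eq' by simp
    qed
    have sX: "summable (\<lambda>j. b (Suc j) * X (m + int n - int (Suc j)))"
      by (rule summable_rabs_cancel)
        (use abs_summable[of "m + int n"] b in \<open>simp add: abs_mult\<close>)
    have "(\<Sum>j. b (Suc j) * X (m + int n - int (Suc j)))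
       = (\<Sum>r. b (Suc (r + (n - 1))) * X (m + int n - int (Suc (r + (n - 1)))))
         + (\<Sum>j<n - 1. b (Suc j) * X (m + int n - int (Suc j)))"
      by (rule suminf_split_initial_segment[OF sX])
    also have "(\<Sum>r. b (Suc (r + (n - 1))) * X (m + int n - int (Suc (r + (n - 1))))) = T"
      unfolding T_def using False by (simp add: algebra_simps of_nat_diff)
    also have "(\<Sum>j<n - 1. b (Suc j) * X (m + int n - int (Suc j)))
        = (\<Sum>i\<in>{1..<n}. b (n - i) * X (m + int i))"
      by (rule sum.reindex_bij_witness[of _ "\<lambda>i. n - Suc i" "\<lambda>i. n - Suc i"])
        (auto simp: of_nat_diff Suc_diff_Suc algebra_simps)
    finally have X: "X (m + int n) = (a + (T + (\<Sum>i\<in>{1..<n}. b (n - i) * X (m + int i)))) * x (m + int n)"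
      using eq[of "m + int n"] by simp
    \<comment> \<open>the path is 0 at time \<open>m\<close>, so this time has no term of its own and stays in \<open>T\<close>\<close>
    have split0: "{..<n} = insert 0 {1..<n}" using False by auto
    have y: "?y n = x (m + int n) * (a + (\<Sum>i\<in>{1..<n}. b (n - i) * ?y i))"
      using False by (subst arch_path_rec) (auto simp: split0)
    have diff: "X (m + int n) - ?y n
        = x (m + int n) * ((\<Sum>i\<in>{1..<n}. b (n - i) * (X (m + int i) - ?y i)) + T)"
      unfolding X y by (simp add: algebra_simps sum_subtractf)
    have "\<bar>X (m + int n) - ?y n\<bar>
        \<le> x (m + int n) * ((\<Sum>i\<in>{1..<n}. b (n - i) * \<bar>X (m + int i) - ?y i\<bar>) + T')"
    proof -
      have "\<bar>(\<Sum>i\<in>{1..<n}. b (n - i) * (X (m + int i) - ?y i)) + T\<bar>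
          \<le> (\<Sum>i\<in>{1..<n}. \<bar>b (n - i) * (X (m + int i) - ?y i)\<bar>) + T'"
        using T by (intro order_trans[OF abs_triangle_ineq] add_mono sum_abs)
      also have "(\<Sum>i\<in>{1..<n}. \<bar>b (n - i) * (X (m + int i) - ?y i)\<bar>)
          = (\<Sum>i\<in>{1..<n}. b (n - i) * \<bar>X (m + int i) - ?y i\<bar>)"
        using b by (intro sum.cong) (auto simp: abs_mult)
      finally show ?thesis
        unfolding diff abs_mult using x[of "m + int n"] by (simp add: mult_left_mono)
    qed
    then have "ennreal \<bar>X (m + int n) - ?y n\<bar>
        \<le> ennreal (x (m + int n) * ((\<Sum>i\<in>{1..<n}. b (n - i) * \<bar>X (m + int i) - ?y i\<bar>) + T'))"
      by (rule ennreal_leI)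
    also have "\<dots> = ennreal (x (m + int n)) *
        ((\<Sum>i\<in>{1..<n}. ennreal (b (n - i)) * ennreal \<bar>X (m + int i) - ?y i\<bar>) + ennreal T')"
    proof -
      have "0 \<le> (\<Sum>i\<in>{1..<n}. b (n - i) * \<bar>X (m + int i) - ?y i\<bar>)"
        using b by (intro sum_nonneg) auto
      moreover have "0 \<le> T'"
        unfolding T'_def using b False by (intro suminf_nonneg sT') auto
      moreover have "ennreal (\<Sum>i\<in>{1..<n}. b (n - i) * \<bar>X (m + int i) - ?y i\<bar>)
          = (\<Sum>i\<in>{1..<n}. ennreal (b (n - i)) * ennreal \<bar>X (m + int i) - ?y i\<bar>)"
        using b by (subst sum_ennreal[symmetric]) (auto simp: ennreal_mult intro!: sum.cong)
      ultimately show ?thesis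
        using x by (simp add: ennreal_mult ennreal_plus)
    qed
    also have "\<dots> \<le> ennreal (x (m + int n)) *
        ((\<Sum>i\<in>{1..<n}. ennreal (b (n - i)) * (\<Sum>r. ennreal (?g r (i + r) * \<bar>X (m - int r)\<bar>)))
          + (\<Sum>r. ennreal (b (n + r) * \<bar>X (m - int r)\<bar>)))"
    proof (intro mult_left_mono add_mono sum_mono)
      fix i assume "i \<in> {1..<n}"
      then show "ennreal \<bar>X (m + int i) - ?y i\<bar> \<le> (\<Sum>r. ennreal (?g r (i + r) * \<bar>X (m - int r)\<bar>))"
        using less by simp
    next
      show "ennreal T' \<le> (\<Sum>r. ennreal (b (n + r) * \<bar>X (m - int r)\<bar>))"
        unfolding T'_def using False b by (subst suminf_ennreal2[OF _ sT']) auto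
    qed auto
    also have "\<dots> = (\<Sum>r. ennreal (x (m + int n)) *
        ((\<Sum>i\<in>{1..<n}. ennreal (b (n - i)) * ennreal (?g r (i + r) * \<bar>X (m - int r)\<bar>))
          + ennreal (b (n + r) * \<bar>X (m - int r)\<bar>)))"
      by (simp add: suminf_sum suminf_add[symmetric])
    also have "\<dots> \<le> (\<Sum>r. ennreal (?g r (n + r) * \<bar>X (m - int r)\<bar>))"
    proof (intro suminf_le allI)
      fix r
      let ?X = "\<bar>X (m - int r)\<bar>"
      \<comment> \<open>only jumps that start at the impulse or after time \<open>m\<close> contribute; the others are dropped\<close>
      have "b (n + r) * ?g r 0 + (\<Sum>i\<in>{1..<n}. b (n - i) * ?g r (i + r))
          = (\<Sum>j\<in>insert 0 {Suc r..<n + r}. b (n + r - j) * ?g r j)"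
        by (simp, rule sum.reindex_bij_witness[of _ "\<lambda>j. j - r" "\<lambda>i. i + r"]) auto
      also have "\<dots> \<le> (\<Sum>j<n + r. b (n + r - j) * ?g r j)"
        using False b g by (intro sum_mono2) (auto intro!: mult_nonneg_nonneg)
      finally have le: "x (m + int n) * (b (n + r) + (\<Sum>i\<in>{1..<n}. b (n - i) * ?g r (i + r))) \<le> ?g r (n + r)"
        using False x[of "m + int n"] by (subst arch_path_rec) (auto intro!: mult_left_mono)
      have S: "(\<Sum>i\<in>{1..<n}. ennreal (b (n - i)) * ennreal (?g r (i + r) * ?X))
          = ennreal (\<Sum>i\<in>{1..<n}. b (n - i) * (?g r (i + r) * ?X))"
        using b g by (subst sum_ennreal[symmetric]) (auto simp: ennreal_mult'' intro!: sum.cong)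
      have nn: "0 \<le> (\<Sum>i\<in>{1..<n}. b (n - i) * (?g r (i + r) * ?X))" "0 \<le> b (n + r) * ?X"
        using b g False by (auto intro!: sum_nonneg)
      have "ennreal (x (m + int n)) * ((\<Sum>i\<in>{1..<n}. ennreal (b (n - i)) * ennreal (?g r (i + r) * ?X))
            + ennreal (b (n + r) * ?X))
          = ennreal (x (m + int n) * ((\<Sum>i\<in>{1..<n}. b (n - i) * (?g r (i + r) * ?X)) + b (n + r) * ?X))"
        unfolding S using nn x by (simp add: ennreal_mult ennreal_plus del: sum_ennreal)
      also have "x (m + int n) * ((\<Sum>i\<in>{1..<n}. b (n - i) * (?g r (i + r) * ?X)) + b (n + r) * ?X)
          = x (m + int n) * (b (n + r) + (\<Sum>i\<in>{1..<n}. b (n - i) * ?g r (i + r))) * ?X"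
        by (simp add: algebra_simps sum_distrib_left sum_distrib_right)
      also have "ennreal \<dots> \<le> ennreal (?g r (n + r) * ?X)"
        using le by (intro ennreal_leI mult_right_mono) auto
      finally show "ennreal (x (m + int n)) *
          ((\<Sum>i\<in>{1..<n}. ennreal (b (n - i)) * ennreal (?g r (i + r) * ?X)) + ennreal (b (n + r) * ?X))
        \<le> ennreal (?g r (n + r) * ?X)" .
    qed auto
    finally show ?thesis .
  qed
qed

text \<open>
  Boundedness in \<open>L\<^sup>2\<close>, here by \<open>sqrt C\<close>, forces a solution to be causal.
\<close>
locale arch_process = arch_data M \<xi> b for M :: "'w measure" and \<xi> and b +
  fixes a C :: real and X :: "int \<Rightarrow> 'w \<Rightarrow> real"
  assumes innovation_nonneg: "AE \<omega> in M. \<xi> k \<omega> \<ge> 0"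
    and solution: "arch_solution M a b \<xi> X"
    and integrable_X2 [simp]: "integrable M (\<lambda>\<omega>. (X k \<omega>)\<^sup>2)"
    and X2_le: "expectation (\<lambda>\<omega>. (X k \<omega>)\<^sup>2) \<le> C"
begin

abbreviation "\<Sigma> \<equiv> arch_volatility a b X"

lemma measurable_X [measurable]: "X k \<in> borel_measurable M"
  using solution by (simp add: arch_solution_def)

lemma measurable_volatility [measurable]: "\<Sigma> k \<in> borel_measurable M"
  unfolding arch_volatility_def[abs_def] by measurable

lemma AE_X: "AE \<omega> in M. X k \<omega> = \<xi> k \<omega> * \<Sigma> k \<omega>"
  using solution by (auto simp: arch_solution_def mult.commute)

lemma C_nonneg: "C \<ge> 0"
  by (rule order_trans[OF _ X2_le[of 0]]) simp

lemma
  assumes [measurable]: "Y \<in> borel_measurable M" and Y: "integrable M (\<lambda>\<omega>. (Y \<omega>)\<^sup>2)"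
  shows integrable_X_times: "integrable M (\<lambda>\<omega>. X k \<omega> * Y \<omega>)"
    and expectation_X_times_le:
      "expectation (\<lambda>\<omega>. \<bar>X k \<omega> * Y \<omega>\<bar>) \<le> sqrt C * sqrt (expectation (\<lambda>\<omega>. (Y \<omega>)\<^sup>2))"
proof -
  show "integrable M (\<lambda>\<omega>. X k \<omega> * Y \<omega>)"
    by (rule L2_product) (auto simp: Y)
  have "expectation (\<lambda>\<omega>. \<bar>X k \<omega> * Y \<omega>\<bar>)
      \<le> sqrt (expectation (\<lambda>\<omega>. (X k \<omega>)\<^sup>2)) * sqrt (expectation (\<lambda>\<omega>. (Y \<omega>)\<^sup>2))"
    by (rule L2_product) (auto simp: Y)
  also have "\<dots> \<le> sqrt C * sqrt (expectation (\<lambda>\<omega>. (Y \<omega>)\<^sup>2))"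
    by (intro mult_right_mono) (auto simp: X2_le)
  finally show "expectation (\<lambda>\<omega>. \<bar>X k \<omega> * Y \<omega>\<bar>) \<le> sqrt C * sqrt (expectation (\<lambda>\<omega>. (Y \<omega>)\<^sup>2))" .
qed

lemma integrable_X [simp]: "integrable M (X k)"
  using integrable_X_times[of "\<lambda>_. 1"] by simp

lemma lam2_pos: "lam2 > 0"
  using sig2_pos zero_le_power2[of lam1] unfolding sig2_def by linarith

lemma summable_b_times: "summable (\<lambda>j. b (Suc j) * c)"
  using summable_b by (rule summable_mult2)

lemma AE_abs_summable: "AE \<omega> in M. \<forall>k. summable (\<lambda>j. b (Suc j) * \<bar>X (k - int (Suc j)) \<omega>\<bar>)"
  unfolding AE_all_countable
proof
  fix k
  have "(\<integral>\<^sup>+\<omega>. (\<Sum>j. ennreal (b (Suc j) * \<bar>X (k - int (Suc j)) \<omega>\<bar>)) \<partial>M)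
      = (\<Sum>j. \<integral>\<^sup>+\<omega>. ennreal (b (Suc j) * \<bar>X (k - int (Suc j)) \<omega>\<bar>) \<partial>M)"
    by (rule nn_integral_suminf) measurable
  also have "\<dots> = (\<Sum>j. ennreal (b (Suc j) * expectation (\<lambda>\<omega>. \<bar>X (k - int (Suc j)) \<omega>\<bar>)))"
    by (subst nn_integral_eq_integral) (auto simp: b_nonneg)
  also have "\<dots> \<le> (\<Sum>j. ennreal (b (Suc j) * sqrt C))"
    using expectation_X_times_le[of "\<lambda>_. 1"]
    by (intro suminf_le ennreal_leI mult_left_mono) (auto simp: b_nonneg prob_space)
  also have "\<dots> = ennreal (\<Sum>j. b (Suc j) * sqrt C)"
    by (rule suminf_ennreal2) (auto simp: b_nonneg C_nonneg summable_b_times)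
  finally have "(\<integral>\<^sup>+\<omega>. (\<Sum>j. ennreal (b (Suc j) * \<bar>X (k - int (Suc j)) \<omega>\<bar>)) \<partial>M) \<noteq> \<infinity>"
    by (auto simp: top_unique)
  then have "AE \<omega> in M. (\<Sum>j. ennreal (b (Suc j) * \<bar>X (k - int (Suc j)) \<omega>\<bar>)) \<noteq> \<infinity>"
    by (rule nn_integral_PInf_AE[rotated]) measurable
  then show "AE \<omega> in M. summable (\<lambda>j. b (Suc j) * \<bar>X (k - int (Suc j)) \<omega>\<bar>)"
    by eventually_elim (rule summable_suminf_not_top, auto simp: b_nonneg)
qed

text \<open>
  As \<open>X (m - int r)\<close> may depend on later innovations, the expectation of its product with the impulse
  response cannot be factored and is estimated by Cauchy-Schwarz.
\<close>
lemma arch_path_L1_error: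
  defines "c \<equiv> \<lambda>n. sqrt (lam2 * expectation (\<lambda>\<omega>. (arch_kick b (\<xi>_from 0 \<omega>) n)\<^sup>2)) * sqrt C"
  assumes n: "0 < n"
  shows "(\<integral>\<^sup>+\<omega>. ennreal \<bar>X (m + int n) \<omega> - arch_path 0 a b (\<xi>_from m \<omega>) n\<bar> \<partial>M) \<le> (\<Sum>r. ennreal (c (n + r)))"
proof -
  let ?g = "\<lambda>r \<omega>. arch_path 1 0 b (\<xi>_from (m - int r) \<omega>) (n + r)"
  have [measurable]: "?g r \<in> borel_measurable M" for r
    by (rule measurable_arch_path) measurable
  have "AE \<omega> in M. \<forall>k. \<xi> k \<omega> \<ge> 0"
    using innovation_nonneg by (simp add: AE_all_countable)
  moreover have "AE \<omega> in M. \<forall>k. X k \<omega> = \<xi> k \<omega> * \<Sigma> k \<omega>"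
    unfolding AE_all_countable using AE_X by (rule allI)
  ultimately have "AE \<omega> in M. ennreal \<bar>X (m + int n) \<omega> - arch_path 0 a b (\<xi>_from m \<omega>) n\<bar>
      \<le> (\<Sum>r. ennreal (?g r \<omega> * \<bar>X (m - int r) \<omega>\<bar>))"
    using AE_abs_summable
  proof eventually_elim
    case (elim \<omega>)
    show ?case
    proof (rule arch_path_error[of "\<lambda>k. \<xi> k \<omega>" b "\<lambda>k. X k \<omega>"])
      show "X k \<omega> = (a + (\<Sum>j. b (Suc j) * X (k - int (Suc j)) \<omega>)) * \<xi> k \<omega>" for k
        using elim(2)[rule_format, of k] unfolding arch_volatility_def by (simp only: mult.commute)
    qed (use elim(1,3) b_nonneg in simp_all)
  qed
  then have "(\<integral>\<^sup>+\<omega>. ennreal \<bar>X (m + int n) \<omega> - arch_path 0 a b (\<xi>_from m \<omega>) n\<bar> \<partial>M)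
      \<le> (\<integral>\<^sup>+\<omega>. (\<Sum>r. ennreal (?g r \<omega> * \<bar>X (m - int r) \<omega>\<bar>)) \<partial>M)"
    by (rule nn_integral_mono_AE)
  also have "\<dots> = (\<Sum>r. \<integral>\<^sup>+\<omega>. ennreal (?g r \<omega> * \<bar>X (m - int r) \<omega>\<bar>) \<partial>M)"
    by (rule nn_integral_suminf) measurable
  also have "\<dots> \<le> (\<Sum>r. ennreal (c (n + r)))"
  proof (intro suminf_le allI)
    fix r
    let ?l = "m - int r"
    have kick: "integrable M (\<lambda>\<omega>. (arch_kick b (\<xi>_from ?l \<omega>) (n + r))\<^sup>2)"
      using n lam1_pos by (intro arch_kick_second_moment) auto
    have g: "?g r \<omega> = \<xi> (?l + int (n + r)) \<omega> * arch_kick b (\<xi>_from ?l \<omega>) (n + r)" for \<omega>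
      using n by (simp add: arch_path_kick)
    note g2 = second_moment_innovation[OF measurable_history_arch_kick kick, folded g]
    have "(\<integral>\<^sup>+\<omega>. ennreal (?g r \<omega> * \<bar>X ?l \<omega>\<bar>) \<partial>M) \<le> (\<integral>\<^sup>+\<omega>. ennreal \<bar>X ?l \<omega> * ?g r \<omega>\<bar> \<partial>M)"
      by (intro nn_integral_mono ennreal_leI) (auto simp: abs_mult mult.commute intro!: mult_left_mono)
    also have "\<dots> = ennreal (expectation (\<lambda>\<omega>. \<bar>X ?l \<omega> * ?g r \<omega>\<bar>))"
      using integrable_X_times[OF _ g2(1)] by (intro nn_integral_eq_integral) auto
    also have "\<dots> \<le> ennreal (sqrt C * sqrt (expectation (\<lambda>\<omega>. (?g r \<omega>)\<^sup>2)))"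
      by (intro ennreal_leI expectation_X_times_le g2(1)) measurable
    also have "sqrt C * sqrt (expectation (\<lambda>\<omega>. (?g r \<omega>)\<^sup>2)) = c (n + r)"
      unfolding g2(2) c_def by (simp add: kick_second_moment_shift[of ?l] mult.commute)
    finally show "(\<integral>\<^sup>+\<omega>. ennreal (?g r \<omega> * \<bar>X ?l \<omega>\<bar>) \<partial>M) \<le> ennreal (c (n + r))" .
  qed auto
  finally show ?thesis .
qed

text \<open>
  Up to a null set, a function of the innovations at times before \<open>k\<close>. The null set is needed since the ARCH
  equations hold almost surely only.
\<close>
definition determined_before :: "int \<Rightarrow> ('w \<Rightarrow> real) \<Rightarrow> bool" where
  "determined_before k Z \<longleftrightarrow> (\<exists>Z'\<in>borel_measurable (history k). AE \<omega> in M. Z \<omega> = Z' \<omega>)"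

text \<open>
  The recursions started with zero past at times \<open>j - Suc n\<close> converge to \<open>X j\<close> in \<open>L\<^sup>1\<close>: their errors are
  tails of the convergent series of norms. A subsequence converges almost surely, and its limit is
  measurable with respect to the history.
\<close>
theorem causal:
  assumes "j < k"
  shows "determined_before k (X j)"
proof -
  define c where "c n = sqrt (lam2 * expectation (\<lambda>\<omega>. (arch_kick b (\<xi>_from 0 \<omega>) n)\<^sup>2)) * sqrt C" for n
  have c_nn: "c n \<ge> 0" for n using lam2_pos by (simp add: c_def C_nonneg)
  have sc: "summable c"
    unfolding c_def[abs_def] real_sqrt_mult
    by (intro summable_mult2 summable_mult summable_kick_norm)
  define Y where "Y n \<omega> = arch_path 0 a b (\<xi>_from (j - int (Suc n)) \<omega>) (Suc n)" for n \<omega>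
  have Y_hist: "Y n \<in> borel_measurable (history k)" for n
    unfolding Y_def using assms by (intro measurable_history_arch_path) simp
  note [measurable] = measurable_historyD[OF Y_hist]
  define e where "e n = (\<Sum>r. c (r + Suc n))" for n
  have err: "(\<integral>\<^sup>+\<omega>. ennreal \<bar>X j \<omega> - Y n \<omega>\<bar> \<partial>M) \<le> ennreal (e n)" for n
  proof -
    have "(\<integral>\<^sup>+\<omega>. ennreal \<bar>X j \<omega> - Y n \<omega>\<bar> \<partial>M) \<le> (\<Sum>r. ennreal (c (r + Suc n)))"
      using arch_path_L1_error[of "Suc n" "j - int (Suc n)"] by (simp add: c_def Y_def add.commute[of n])
    also have "\<dots> = ennreal (e n)"
      unfolding e_def using summable_ignore_initial_segment[OF sc, of "Suc n"]
      by (intro suminf_ennreal2) (auto simp: c_nn)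
    finally show ?thesis .
  qed
  have int: "integrable M (\<lambda>\<omega>. X j \<omega> - Y n \<omega>)" for n
    using err[of n] by (intro integrableI_bounded) (auto intro: le_less_trans)
  have "(\<lambda>n. suminf c - (\<Sum>i<Suc n. c i)) \<longlonglongrightarrow> suminf c - suminf c"
    by (intro tendsto_diff tendsto_const LIMSEQ_Suc summable_LIMSEQ sc)
  also have "(\<lambda>n. suminf c - (\<Sum>i<Suc n. c i)) = e"
    by (rule ext) (simp only: e_def suminf_minus_initial_segment[OF sc])
  finally have "e \<longlonglongrightarrow> 0" by simp
  then have "(\<lambda>n. expectation (\<lambda>\<omega>. norm (X j \<omega> - Y n \<omega>))) \<longlonglongrightarrow> 0"
  proof (rule tendsto_sandwich[OF _ _ tendsto_const, rotated 2])
    have e_nn: "e n \<ge> 0" for n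
      unfolding e_def using summable_ignore_initial_segment[OF sc, of "Suc n"]
      by (intro suminf_nonneg) (auto simp: c_nn)
    have "expectation (\<lambda>\<omega>. norm (X j \<omega> - Y n \<omega>)) \<le> e n" for n
      using err[of n] int[of n] by (simp add: nn_integral_eq_integral ennreal_le_iff e_nn)
    then show "\<forall>\<^sub>F n in sequentially. expectation (\<lambda>\<omega>. norm (X j \<omega> - Y n \<omega>)) \<le> e n"
      by simp
  qed simp
  from tendsto_L1_AE_subseq[OF int this] obtain r where
    r: "AE \<omega> in M. (\<lambda>n. X j \<omega> - Y (r n) \<omega>) \<longlonglongrightarrow> 0" by blast
  have "AE \<omega> in M. X j \<omega> = lim (\<lambda>n. Y (r n) \<omega>)"
    using r
  proof eventually_elim
    case (elim \<omega>)
    have "(\<lambda>n. X j \<omega> - (X j \<omega> - Y (r n) \<omega>)) \<longlonglongrightarrow> X j \<omega> - 0"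
      by (intro tendsto_diff tendsto_const elim)
    then show ?case by (simp add: limI)
  qed
  moreover have "(\<lambda>\<omega>. lim (\<lambda>n. Y (r n) \<omega>)) \<in> borel_measurable (history k)"
    using Y_hist by (rule borel_measurable_lim_metric)
  ultimately show ?thesis
    unfolding determined_before_def by (intro bexI)
qed

end

section \<open>Summation against the resolvent\<close>

lemma infsum_UNIV_eq_suminf:
  fixes f :: "nat \<Rightarrow> 'b :: banach"
  assumes "summable (\<lambda>n. norm (f n))"
  shows "infsum f UNIV = suminf f"
  using norm_summable_imp_has_sum[OF assms summable_sums[OF summable_norm_cancel[OF assms]]]
  by (rule infsumI)

text \<open>
  Multiply the equation for \<open>r n\<close> by \<open>z n\<close> and sum over \<open>n\<close>. Collecting the double series along
  \<open>p = n + j\<close>, the factor of \<open>r (Suc p)\<close> is \<open>l * (\<Sum>n\<le>p. b (Suc p - n) * z n) = z (Suc p)\<close>. So all terms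
  \<open>z p * r p\<close> with \<open>p \<ge> 1\<close> cancel, and \<open>r 0 = c * (\<Sum>n. (z n)\<^sup>2)\<close> is left.
\<close>
lemma weighted_renewal_sum:
  fixes r :: "nat \<Rightarrow> real"
  assumes l: "l \<ge> 0" and b: "\<And>j. j \<ge> 1 \<Longrightarrow> b j \<ge> 0"
    and sb: "summable (\<lambda>j. b (Suc j))" and lB: "l * (\<Sum>j. b (Suc j)) < 1"
    and r: "\<And>n. \<bar>r n\<bar> \<le> K"
    and eq: "\<And>n. r n = l * (\<Sum>j. b (Suc j) * r (n + Suc j)) + c * arch_z l b n"
  shows "r 0 = c * (\<Sum>n. (arch_z l b n)\<^sup>2)"
proof -
  let ?z = "arch_z l b"
  have z: "?z n \<ge> 0" for n using arch_z_nonneg[of l b] l b by blast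
  have sz: "summable ?z" by (rule summable_arch_z[OF l b sb lB])
  have K: "K \<ge> 0" using r[of 0] by linarith
  define f where "f = (\<lambda>(n, j). ?z n * (b (Suc j) * r (n + Suc j)))"
  have f_le: "norm (f (n, j)) \<le> ?z n * (b (Suc j) * K)" for n j
    using z[of n] b[of "Suc j"] r[of "n + Suc j"] unfolding f_def
    by (auto simp: abs_mult intro!: mult_left_mono)
  have row: "summable (\<lambda>j. norm (f (n, j)))" for n
    by (rule summable_comparison_test'[where g = "\<lambda>j. ?z n * (b (Suc j) * K)"])
      (use f_le in \<open>auto intro!: summable_mult summable_mult2 sb\<close>)
  have f: "(\<lambda>x. norm (f x)) summable_on UNIV \<times> UNIV"
  proof (subst Infinite_Sum.abs_summable_on_Sigma_iff, intro conjI ballI)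
    show "(\<lambda>j. norm (f (n, j))) summable_on UNIV" for n
      using row[of n] by (simp add: norm_summable_imp_summable_on summable_on_UNIV_nonneg_real_iff)
    show "(\<lambda>n. norm (\<Sum>\<^sub>\<infinity>j\<in>UNIV. norm (f (n, j)))) summable_on UNIV"
    proof -
      have "(\<Sum>\<^sub>\<infinity>j\<in>UNIV. norm (f (n, j))) = (\<Sum>j. norm (f (n, j)))" for n
        using row[of n] by (intro infsum_UNIV_eq_suminf) simp
      moreover have "summable (\<lambda>n. norm (\<Sum>j. norm (f (n, j))))"
      proof (rule summable_comparison_test'[where g = "\<lambda>n. ?z n * (\<Sum>j. b (Suc j) * K)"])
        show "summable (\<lambda>n. ?z n * (\<Sum>j. b (Suc j) * K))" by (rule summable_mult2[OF sz])
        fix n :: nat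
        have "(\<Sum>j. norm (f (n, j))) \<le> (\<Sum>j. ?z n * (b (Suc j) * K))"
          by (intro suminf_le row f_le summable_mult summable_mult2 sb)
        also have "\<dots> = ?z n * (\<Sum>j. b (Suc j) * K)"
          by (intro suminf_mult summable_mult2 sb)
        finally show "norm (norm (\<Sum>j. norm (f (n, j)))) \<le> ?z n * (\<Sum>j. b (Suc j) * K)"
          using suminf_nonneg[OF row[of n]] by simp
      qed
      ultimately show ?thesis
        by (simp add: summable_on_UNIV_nonneg_real_iff)
    qed
  qed
  then have f': "f summable_on UNIV \<times> UNIV" by (rule Infinite_Sum.abs_summable_summable)
  let ?T = "SIGMA p:UNIV. {..p::nat}"
  have bij: "bij_betw (\<lambda>(p, n). (n, p - n)) ?T (UNIV \<times> UNIV)"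
    by (rule bij_betw_byWitness[where f' = "\<lambda>(n, j). (n + j, n)"]) auto
  have diag: "(\<lambda>(p, n). f (n, p - n)) summable_on ?T"
    using summable_on_reindex_bij_betw[OF bij, of f] f' by (simp add: case_prod_unfold)
  have "(\<Sum>\<^sub>\<infinity>n\<in>UNIV. \<Sum>\<^sub>\<infinity>j\<in>UNIV. f (n, j)) = infsum f (UNIV \<times> UNIV)"
    using infsum_Sigma'_banach[of "\<lambda>n j. f (n, j)" UNIV "\<lambda>_. UNIV"] f' by simp
  also have "\<dots> = infsum (\<lambda>(p, n). f (n, p - n)) ?T"
    using infsum_reindex_bij_betw[OF bij, of f] by (simp add: case_prod_unfold)
  also have "\<dots> = (\<Sum>\<^sub>\<infinity>p\<in>UNIV. \<Sum>\<^sub>\<infinity>n\<in>{..p}. f (n, p - n))"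
    by (rule infsum_Sigma'_banach[OF diag, symmetric])
  finally have swap: "(\<Sum>\<^sub>\<infinity>n\<in>UNIV. \<Sum>\<^sub>\<infinity>j\<in>UNIV. f (n, j)) = (\<Sum>\<^sub>\<infinity>p\<in>UNIV. \<Sum>\<^sub>\<infinity>n\<in>{..p}. f (n, p - n))" .
  have zr: "summable (\<lambda>n. norm (?z n * r n))"
    by (rule summable_comparison_test'[where g = "\<lambda>n. ?z n * K"])
      (use z r in \<open>auto simp: abs_mult intro!: summable_mult2 sz mult_left_mono\<close>)
  have rows: "l * (\<Sum>\<^sub>\<infinity>j\<in>UNIV. f (n, j)) = ?z n * r n - c * (?z n)\<^sup>2" for n
  proof -
    have "summable (\<lambda>j. norm (b (Suc j) * r (n + Suc j)))"
      by (rule summable_comparison_test'[where g = "\<lambda>j. b (Suc j) * K"])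
        (use b r in \<open>auto simp: abs_mult intro!: summable_mult2 sb mult_left_mono\<close>)
    then have "(\<Sum>j. f (n, j)) = ?z n * (\<Sum>j. b (Suc j) * r (n + Suc j))"
      unfolding f_def by (simp add: suminf_mult summable_norm_cancel)
    moreover have "(\<Sum>\<^sub>\<infinity>j\<in>UNIV. f (n, j)) = (\<Sum>j. f (n, j))"
      using row by (rule infsum_UNIV_eq_suminf)
    ultimately show ?thesis
      using eq[of n] by (simp add: algebra_simps power2_eq_square)
  qed
  have cols: "l * (\<Sum>\<^sub>\<infinity>n\<in>{..p}. f (n, p - n)) = ?z (Suc p) * r (Suc p)" for p
  proof -
    have "l * (\<Sum>\<^sub>\<infinity>n\<in>{..p}. f (n, p - n)) = l * (\<Sum>n<Suc p. b (Suc p - n) * ?z n) * r (Suc p)"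
      by (simp add: f_def lessThan_Suc_atMost sum_distrib_left sum_distrib_right Suc_diff_le mult_ac
          del: sum.lessThan_Suc)
    then show ?thesis by (simp add: arch_z_rec[of "Suc p"])
  qed
  have sz2: "summable (\<lambda>n. (?z n)\<^sup>2)" by (rule summable_power2_of_summable[OF sz z])
  have "(\<Sum>n. ?z n * r n - c * (?z n)\<^sup>2) = (\<Sum>\<^sub>\<infinity>n\<in>UNIV. ?z n * r n - c * (?z n)\<^sup>2)"
  proof (rule infsum_UNIV_eq_suminf[symmetric])
    show "summable (\<lambda>n. norm (?z n * r n - c * (?z n)\<^sup>2))"
    proof (rule summable_comparison_test')
      show "summable (\<lambda>n. norm (?z n * r n) + \<bar>c\<bar> * (?z n)\<^sup>2)"
        by (rule summable_add[OF zr summable_mult[OF sz2]])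
      show "norm (norm (?z n * r n - c * (?z n)\<^sup>2)) \<le> norm (?z n * r n) + \<bar>c\<bar> * (?z n)\<^sup>2" for n
        using norm_triangle_ineq4[of "?z n * r n" "c * (?z n)\<^sup>2"] by (simp add: abs_mult)
    qed
  qed
  also have "\<dots> = l * (\<Sum>\<^sub>\<infinity>n\<in>UNIV. \<Sum>\<^sub>\<infinity>j\<in>UNIV. f (n, j))"
    unfolding rows[symmetric] by (rule infsum_cmult_right')
  also have "\<dots> = (\<Sum>\<^sub>\<infinity>p\<in>UNIV. ?z (Suc p) * r (Suc p))"
    unfolding swap cols[symmetric] by (rule infsum_cmult_right'[symmetric])
  also have "\<dots> = (\<Sum>p. ?z (Suc p) * r (Suc p))"
    by (rule infsum_UNIV_eq_suminf) (rule zr[THEN summable_Suc_iff[THEN iffD2]])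
  also have "\<dots> = (\<Sum>n. ?z n * r n) - r 0"
    using suminf_split_head[OF summable_norm_cancel[OF zr]] by simp
  finally have "(\<Sum>n. ?z n * r n) - (\<Sum>n. c * (?z n)\<^sup>2) = (\<Sum>n. ?z n * r n) - r 0"
    using suminf_diff[OF summable_norm_cancel[OF zr] summable_mult[OF sz2, of c]] by simp
  then show ?thesis using suminf_mult[OF sz2, of c] by simp
qed

section \<open>Orthogonality of nu to the past\<close>

lemma (in prob_space) indep_var_nn_integral:
  fixes U W :: "'a \<Rightarrow> ennreal"
  assumes "indep_var borel U borel W"
  shows "(\<integral>\<^sup>+\<omega>. U \<omega> * W \<omega> \<partial>M) = (\<integral>\<^sup>+\<omega>. U \<omega> \<partial>M) * (\<integral>\<^sup>+\<omega>. W \<omega> \<partial>M)"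
proof -
  have "case_bool borel borel = (\<lambda>_. borel :: ennreal measure)"
    by (rule ext) (simp split: bool.split)
  then have "indep_vars (\<lambda>_. borel) (case_bool U W) UNIV"
    using assms by (simp add: indep_var_def)
  from indep_vars_nn_integral[OF _ this] show ?thesis
    by (simp add: UNIV_bool mult.commute)
qed

context arch_process
begin

lemma determined_before_const: "determined_before k (\<lambda>_. c)"
  unfolding determined_before_def by (rule bexI[of _ "\<lambda>_. c"]) auto

lemma determined_before_mult:
  assumes "determined_before k U" "determined_before k W"
  shows "determined_before k (\<lambda>\<omega>. U \<omega> * W \<omega>)"
proof -
  obtain U' W' where "U' \<in> borel_measurable (history k)" "W' \<in> borel_measurable (history k)"
    and eq: "AE \<omega> in M. U \<omega> = U' \<omega>" "AE \<omega> in M. W \<omega> = W' \<omega>"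
    using assms unfolding determined_before_def by blast
  moreover have "AE \<omega> in M. U \<omega> * W \<omega> = U' \<omega> * W' \<omega>"
    using eq by eventually_elim simp
  ultimately show ?thesis
    unfolding determined_before_def by (intro bexI[of _ "\<lambda>\<omega>. U' \<omega> * W' \<omega>"]) auto
qed

lemma determined_before_volatility:
  assumes "j \<le> k"
  shows "determined_before k (\<Sigma> j)"
proof -
  have "\<forall>i. \<exists>Z. Z \<in> borel_measurable (history k) \<and> (AE \<omega> in M. X (j - int (Suc i)) \<omega> = Z \<omega>)"
    using causal[of "j - int (Suc _)" k] assms unfolding determined_before_def by fastforce
  then obtain Z where Z: "\<And>i. Z i \<in> borel_measurable (history k)"
    and eq: "\<And>i. AE \<omega> in M. X (j - int (Suc i)) \<omega> = Z i \<omega>" by metis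
  have "AE \<omega> in M. \<forall>i. X (j - int (Suc i)) \<omega> = Z i \<omega>"
    unfolding AE_all_countable using eq by blast
  then have eq': "AE \<omega> in M. \<Sigma> j \<omega> = a + (\<Sum>i. b (Suc i) * Z i \<omega>)"
    by eventually_elim (simp add: arch_volatility_def)
  note [measurable] = Z
  have "(\<lambda>\<omega>. a + (\<Sum>i. b (Suc i) * Z i \<omega>)) \<in> borel_measurable (history k)"
    by measurable
  with eq' show ?thesis unfolding determined_before_def by (intro bexI)
qed

lemma determined_innovation_uncorrelated:
  assumes Z: "determined_before k Z" "Z \<in> borel_measurable M" "integrable M Z"
  shows "expectation (\<lambda>\<omega>. (\<xi> k \<omega> - lam1) * Z \<omega>) = 0"
proof -
  obtain Z' where Z': "Z' \<in> borel_measurable (history k)" and eq: "AE \<omega> in M. Z \<omega> = Z' \<omega>"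
    using Z(1) unfolding determined_before_def by blast
  note [measurable] = Z(2) measurable_historyD[OF Z']
  have "integrable M Z'"
    using Z(3) integrable_cong_AE[OF _ _ eq] by simp
  then have "expectation (\<lambda>\<omega>. (\<xi> k \<omega> - lam1) * Z' \<omega>) = 0"
    using expectation_innovation_history(2)[of "\<lambda>x. x - lam1" k Z'] Z' by simp
  also have "expectation (\<lambda>\<omega>. (\<xi> k \<omega> - lam1) * Z' \<omega>) = expectation (\<lambda>\<omega>. (\<xi> k \<omega> - lam1) * Z \<omega>)"
    by (rule integral_cong_AE) (use eq in auto)
  finally show ?thesis .
qed

text \<open>
  Square integrability of the volatility is inferred from that of \<open>X\<close>: by independence the integral of
  \<open>(X k)\<^sup>2\<close> factors, with the possible value \<open>\<infinity>\<close>, and \<open>lam2 > 0\<close>.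
\<close>
lemma volatility_second_moment:
  shows integrable_volatility2 [simp]: "integrable M (\<lambda>\<omega>. (\<Sigma> k \<omega>)\<^sup>2)"
    and "expectation (\<lambda>\<omega>. (X k \<omega>)\<^sup>2) = lam2 * expectation (\<lambda>\<omega>. (\<Sigma> k \<omega>)\<^sup>2)"
    and "expectation (\<lambda>\<omega>. (X k \<omega> - lam1 * \<Sigma> k \<omega>)\<^sup>2) = sig2 * expectation (\<lambda>\<omega>. (\<Sigma> k \<omega>)\<^sup>2)"
proof -
  obtain S where S: "S \<in> borel_measurable (history k)" and eq: "AE \<omega> in M. \<Sigma> k \<omega> = S \<omega>"
    using determined_before_volatility[of k k] unfolding determined_before_def by blast
  note [measurable] = measurable_historyD[OF S]
  have X: "AE \<omega> in M. X k \<omega> = \<xi> k \<omega> * S \<omega>"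
    using AE_X[of k] eq by eventually_elim simp
  have "indep_var borel ((\<lambda>x. ennreal (x\<^sup>2)) \<circ> \<xi> k) borel ((\<lambda>x. ennreal (x\<^sup>2)) \<circ> S)"
    by (rule indep_var_compose[OF indep_var_history[OF S]]) auto
  from indep_var_nn_integral[OF this]
  have "(\<integral>\<^sup>+\<omega>. ennreal ((\<xi> k \<omega> * S \<omega>)\<^sup>2) \<partial>M) = ennreal lam2 * (\<integral>\<^sup>+\<omega>. ennreal ((S \<omega>)\<^sup>2) \<partial>M)"
    by (simp add: power_mult_distrib ennreal_mult nn_integral_eq_integral)
  moreover have "(\<integral>\<^sup>+\<omega>. ennreal ((\<xi> k \<omega> * S \<omega>)\<^sup>2) \<partial>M) = (\<integral>\<^sup>+\<omega>. ennreal ((X k \<omega>)\<^sup>2) \<partial>M)"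
    by (rule nn_integral_cong_AE) (use X in auto)
  moreover have "\<dots> < \<infinity>" by (simp add: nn_integral_eq_integral)
  ultimately have "(\<integral>\<^sup>+\<omega>. ennreal ((S \<omega>)\<^sup>2) \<partial>M) < \<infinity>"
    using lam2_pos by (auto simp: ennreal_mult_less_top)
  then have S2: "integrable M (\<lambda>\<omega>. (S \<omega>)\<^sup>2)"
    by (intro integrableI_bounded) auto
  have eq2: "AE \<omega> in M. (\<Sigma> k \<omega>)\<^sup>2 = (S \<omega>)\<^sup>2"
    using eq by eventually_elim simp
  show "integrable M (\<lambda>\<omega>. (\<Sigma> k \<omega>)\<^sup>2)"
    using integrable_cong_AE[OF _ _ eq2] S2 by simp
  have ES: "expectation (\<lambda>\<omega>. (\<Sigma> k \<omega>)\<^sup>2) = expectation (\<lambda>\<omega>. (S \<omega>)\<^sup>2)"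
    by (rule integral_cong_AE[OF _ _ eq2]) auto
  have "expectation (\<lambda>\<omega>. (X k \<omega>)\<^sup>2) = expectation (\<lambda>\<omega>. (\<xi> k \<omega> * S \<omega>)\<^sup>2)"
    by (rule integral_cong_AE) (use X in auto)
  then show "expectation (\<lambda>\<omega>. (X k \<omega>)\<^sup>2) = lam2 * expectation (\<lambda>\<omega>. (\<Sigma> k \<omega>)\<^sup>2)"
    using second_moment_innovation(2)[OF S S2] ES by simp
  have "AE \<omega> in M. (X k \<omega> - lam1 * \<Sigma> k \<omega>)\<^sup>2 = (\<xi> k \<omega> - lam1)\<^sup>2 * (S \<omega>)\<^sup>2"
    using X eq by eventually_elim (simp add: power_mult_distrib[symmetric] algebra_simps)
  then have "expectation (\<lambda>\<omega>. (X k \<omega> - lam1 * \<Sigma> k \<omega>)\<^sup>2) = expectation (\<lambda>\<omega>. (\<xi> k \<omega> - lam1)\<^sup>2 * (S \<omega>)\<^sup>2)"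
    by (intro integral_cong_AE) auto
  then show "expectation (\<lambda>\<omega>. (X k \<omega> - lam1 * \<Sigma> k \<omega>)\<^sup>2) = sig2 * expectation (\<lambda>\<omega>. (\<Sigma> k \<omega>)\<^sup>2)"
    using expectation_innovation_history(2)[of "\<lambda>x. (x - lam1)\<^sup>2" k "\<lambda>\<omega>. (S \<omega>)\<^sup>2"] S S2 ES by simp
qed

lemma expectation_volatility_times:
  assumes [measurable]: "Y \<in> borel_measurable M" and Y: "integrable M (\<lambda>\<omega>. (Y \<omega>)\<^sup>2)"
  shows "expectation (\<lambda>\<omega>. \<Sigma> k \<omega> * Y \<omega>)
      = a * expectation Y + (\<Sum>j. b (Suc j) * expectation (\<lambda>\<omega>. X (k - int (Suc j)) \<omega> * Y \<omega>))"
proof -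
  define f where "f j \<omega> = b (Suc j) * (X (k - int (Suc j)) \<omega> * Y \<omega>)" for j \<omega>
  have f: "integrable M (f j)" for j
    unfolding f_def[abs_def] by (intro integrable_mult_right integrable_X_times Y) measurable
  have sf: "AE \<omega> in M. summable (\<lambda>j. norm (f j \<omega>))"
    using AE_abs_summable
  proof eventually_elim
    case (elim \<omega>)
    have "summable (\<lambda>j. b (Suc j) * \<bar>X (k - int (Suc j)) \<omega>\<bar> * \<bar>Y \<omega>\<bar>)"
      by (intro summable_mult2 elim[rule_format])
    then show ?case by (simp add: f_def abs_mult b_nonneg mult.assoc)
  qed
  have nf: "summable (\<lambda>j. expectation (\<lambda>\<omega>. norm (f j \<omega>)))"
  proof (rule summable_comparison_test'[OF summable_b_times])
    fix j :: nat
    have "expectation (\<lambda>\<omega>. norm (f j \<omega>)) = b (Suc j) * expectation (\<lambda>\<omega>. \<bar>X (k - int (Suc j)) \<omega> * Y \<omega>\<bar>)"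
      by (simp add: f_def abs_mult[of "b (Suc j)"] b_nonneg del: abs_mult)
    also have "\<dots> \<le> b (Suc j) * (sqrt C * sqrt (expectation (\<lambda>\<omega>. (Y \<omega>)\<^sup>2)))"
      by (intro mult_left_mono expectation_X_times_le Y b_nonneg) auto
    finally show "norm (expectation (\<lambda>\<omega>. norm (f j \<omega>)))
        \<le> b (Suc j) * (sqrt C * sqrt (expectation (\<lambda>\<omega>. (Y \<omega>)\<^sup>2)))" by simp
  qed
  have Ef: "expectation (f j) = b (Suc j) * expectation (\<lambda>\<omega>. X (k - int (Suc j)) \<omega> * Y \<omega>)" for j
    by (simp add: f_def[abs_def])
  have Y1: "integrable M Y" using L2_product(1)[of "\<lambda>_. 1" M Y] Y by simp
  have [measurable]: "f j \<in> borel_measurable M" for j using f by auto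
  have "AE \<omega> in M. \<Sigma> k \<omega> * Y \<omega> = a * Y \<omega> + (\<Sum>j. f j \<omega>)"
    using AE_abs_summable
  proof eventually_elim
    case (elim \<omega>)
    have "summable (\<lambda>j. b (Suc j) * X (k - int (Suc j)) \<omega>)"
      using elim[rule_format, of k]
      by (intro summable_norm_cancel[of "\<lambda>j. b (Suc j) * X (k - int (Suc j)) \<omega>"])
        (simp add: abs_mult b_nonneg)
    then show ?case
      by (simp add: arch_volatility_def f_def distrib_right suminf_mult2 mult.assoc)
  qed
  then have "expectation (\<lambda>\<omega>. \<Sigma> k \<omega> * Y \<omega>) = expectation (\<lambda>\<omega>. a * Y \<omega> + (\<Sum>j. f j \<omega>))"
    by (intro integral_cong_AE) auto
  also have "\<dots> = a * expectation Y + (\<Sum>j. expectation (f j))"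
    using Y1 integrable_suminf[OF f sf nf] integral_suminf[OF f sf nf] by simp
  finally show "expectation (\<lambda>\<omega>. \<Sigma> k \<omega> * Y \<omega>)
      = a * expectation Y + (\<Sum>j. b (Suc j) * expectation (\<lambda>\<omega>. X (k - int (Suc j)) \<omega> * Y \<omega>))"
    by (simp add: Ef)
qed

definition \<nu> :: "int \<Rightarrow> 'w \<Rightarrow> real" where
  "\<nu> k \<omega> = X k \<omega> - lam1 * \<Sigma> k \<omega>"

lemma measurable_\<nu> [measurable]: "\<nu> k \<in> borel_measurable M"
  unfolding \<nu>_def[abs_def] by measurable

lemma integrable_\<nu>2 [simp]: "integrable M (\<lambda>\<omega>. (\<nu> k \<omega>)\<^sup>2)"
proof -
  have "integrable M (\<lambda>\<omega>. X k \<omega> * \<Sigma> k \<omega>)" by (rule L2_product) auto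
  then have "integrable M (\<lambda>\<omega>. (X k \<omega>)\<^sup>2 + lam1\<^sup>2 * (\<Sigma> k \<omega>)\<^sup>2 - 2 * lam1 * (X k \<omega> * \<Sigma> k \<omega>))"
    by simp
  then show ?thesis
    by (simp add: \<nu>_def power2_diff power_mult_distrib mult_ac)
qed

text \<open>
  This holds because \<open>\<nu> k = (\<xi> k - lam1) * \<Sigma> k\<close> almost surely, and \<open>\<Sigma> k * Z\<close> is determined before \<open>k\<close>.
\<close>
lemma \<nu>_uncorrelated:
  assumes [measurable]: "Z \<in> borel_measurable M" and Z: "integrable M (\<lambda>\<omega>. (Z \<omega>)\<^sup>2)" "determined_before k Z"
  shows "expectation (\<lambda>\<omega>. \<nu> k \<omega> * Z \<omega>) = 0"
proof -
  have "AE \<omega> in M. \<nu> k \<omega> * Z \<omega> = (\<xi> k \<omega> - lam1) * (\<Sigma> k \<omega> * Z \<omega>)"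
    using AE_X[of k] by eventually_elim (simp add: \<nu>_def algebra_simps)
  then have "expectation (\<lambda>\<omega>. \<nu> k \<omega> * Z \<omega>) = expectation (\<lambda>\<omega>. (\<xi> k \<omega> - lam1) * (\<Sigma> k \<omega> * Z \<omega>))"
    by (intro integral_cong_AE) auto
  also have "\<dots> = 0"
    by (intro determined_innovation_uncorrelated determined_before_mult determined_before_volatility
        L2_product(1)) (auto simp: Z)
  finally show ?thesis .
qed

lemma determined_before_\<nu>: "j < k \<Longrightarrow> determined_before k (\<nu> j)"
proof -
  assume "j < k"
  then obtain U W where "U \<in> borel_measurable (history k)" "W \<in> borel_measurable (history k)"
    and eq: "AE \<omega> in M. X j \<omega> = U \<omega>" "AE \<omega> in M. \<Sigma> j \<omega> = W \<omega>"
    using causal[of j k] determined_before_volatility[of j k] unfolding determined_before_def by auto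
  moreover have "AE \<omega> in M. \<nu> j \<omega> = U \<omega> - lam1 * W \<omega>"
    using eq by eventually_elim (simp add: \<nu>_def)
  ultimately show ?thesis
    unfolding determined_before_def by (intro bexI[of _ "\<lambda>\<omega>. U \<omega> - lam1 * W \<omega>"]) auto
qed

text \<open>
  The equation \<open>X k = lam1 * \<Sigma> k + \<nu> k\<close> tested against \<open>Y\<close>. The choice \<open>Y = X 0\<close> yields the equations for
  the autocovariance, \<open>Y = \<nu> m\<close> the impulse response in the mean, and \<open>Y = 1\<close> the mean.
\<close>
lemma expectation_X_times:
  assumes [measurable]: "Y \<in> borel_measurable M" and Y: "integrable M (\<lambda>\<omega>. (Y \<omega>)\<^sup>2)"
  shows "expectation (\<lambda>\<omega>. X k \<omega> * Y \<omega>)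
    = lam1 * (a * expectation Y + (\<Sum>j. b (Suc j) * expectation (\<lambda>\<omega>. X (k - int (Suc j)) \<omega> * Y \<omega>)))
      + expectation (\<lambda>\<omega>. \<nu> k \<omega> * Y \<omega>)"
proof -
  have "expectation (\<lambda>\<omega>. X k \<omega> * Y \<omega>) = expectation (\<lambda>\<omega>. lam1 * (\<Sigma> k \<omega> * Y \<omega>) + \<nu> k \<omega> * Y \<omega>)"
    by (simp add: \<nu>_def algebra_simps)
  also have "\<dots> = lam1 * expectation (\<lambda>\<omega>. \<Sigma> k \<omega> * Y \<omega>) + expectation (\<lambda>\<omega>. \<nu> k \<omega> * Y \<omega>)"
    using L2_product(1)[of "\<Sigma> k" M Y] L2_product(1)[of "\<nu> k" M Y] Y by simp
  finally show ?thesis using expectation_volatility_times[OF _ Y] by simp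
qed

lemma expectation_\<nu>: "expectation (\<nu> k) = 0"
  using \<nu>_uncorrelated[of "\<lambda>_. 1" k] determined_before_const by simp

text \<open>
  The expectation of \<open>\<nu> m * X k\<close> vanishes for \<open>k < m\<close> and equals \<open>c m\<close> for \<open>k = m\<close>. At later times it
  obeys the recursion of \<open>z\<close>, because \<open>\<nu> (m + int n)\<close> is orthogonal to \<open>\<nu> m\<close>.
\<close>
lemma expectation_\<nu>_X:
  defines "c \<equiv> \<lambda>m. sig2 * expectation (\<lambda>\<omega>. (\<Sigma> m \<omega>)\<^sup>2)"
  shows "expectation (\<lambda>\<omega>. \<nu> m \<omega> * X (m + int n) \<omega>) = c m * z n"
proof (induction n rule: less_induct)
  case (less n)
  show ?case
  proof (cases "n = 0")
    case True
    have "expectation (\<lambda>\<omega>. \<nu> m \<omega> * X m \<omega>) = expectation (\<lambda>\<omega>. (\<nu> m \<omega>)\<^sup>2 + lam1 * (\<nu> m \<omega> * \<Sigma> m \<omega>))"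
      by (simp add: \<nu>_def power2_eq_square algebra_simps)
    also have "\<dots> = expectation (\<lambda>\<omega>. (\<nu> m \<omega>)\<^sup>2) + lam1 * expectation (\<lambda>\<omega>. \<nu> m \<omega> * \<Sigma> m \<omega>)"
      using L2_product(1)[of "\<nu> m" M "\<Sigma> m"] by simp
    also have "\<dots> = c m"
      using \<nu>_uncorrelated[of "\<Sigma> m" m] determined_before_volatility[of m m] volatility_second_moment(3)[of m]
      by (simp add: c_def \<nu>_def)
    finally show ?thesis using True by simp
  next
    case False
    let ?k = "m + int n"
    have tail: "expectation (\<lambda>\<omega>. X (?k - int (Suc j)) \<omega> * \<nu> m \<omega>) = 0" if "j \<notin> {..<n}" for j
      using \<nu>_uncorrelated[of "X (?k - int (Suc j))" m] causal[of "?k - int (Suc j)" m] that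
      by (simp add: mult.commute)
    have head: "expectation (\<lambda>\<omega>. X (?k - int (Suc j)) \<omega> * \<nu> m \<omega>) = c m * z (n - Suc j)" if "j < n" for j
    proof -
      have k: "?k - int (Suc j) = m + int (n - Suc j)" using that by (simp add: of_nat_diff)
      have "expectation (\<lambda>\<omega>. \<nu> m \<omega> * X (m + int (n - Suc j)) \<omega>) = c m * z (n - Suc j)"
        using less[of "n - Suc j"] that by simp
      then show ?thesis unfolding k by (simp only: mult.commute)
    qed
    have "expectation (\<lambda>\<omega>. X ?k \<omega> * \<nu> m \<omega>)
        = lam1 * (\<Sum>j. b (Suc j) * expectation (\<lambda>\<omega>. X (?k - int (Suc j)) \<omega> * \<nu> m \<omega>))"
      using expectation_X_times[of "\<nu> m" ?k] \<nu>_uncorrelated[of "\<nu> m" ?k] determined_before_\<nu>[of m ?k] False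
      by (simp add: expectation_\<nu>)
    also have "(\<Sum>j. b (Suc j) * expectation (\<lambda>\<omega>. X (?k - int (Suc j)) \<omega> * \<nu> m \<omega>))
        = (\<Sum>j<n. b (Suc j) * expectation (\<lambda>\<omega>. X (?k - int (Suc j)) \<omega> * \<nu> m \<omega>))"
      by (rule suminf_finite) (use tail in auto)
    also have "\<dots> = (\<Sum>j<n. b (Suc j) * (c m * z (n - Suc j)))"
      by (intro sum.cong refl) (use head in auto)
    also have "\<dots> = (\<Sum>i<n. b (n - i) * (c m * z i))"
      by (rule sum.reindex_bij_witness[of _ "\<lambda>i. n - Suc i" "\<lambda>i. n - Suc i"]) (auto simp: Suc_diff_Suc)
    also have "lam1 * \<dots> = c m * z n"
      using False by (simp add: arch_z_rec[of n] sum_distrib_left mult_ac)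
    finally show ?thesis by (simp add: mult.commute)
  qed
qed

end

section \<open>The autocovariance function of a stationary solution\<close>

lemma (in prob_space) covariance_L2:
  assumes [measurable]: "Y \<in> borel_measurable M" "Z \<in> borel_measurable M"
    and Y: "integrable M Y" "integrable M (\<lambda>\<omega>. (Y \<omega>)\<^sup>2)"
    and Z: "integrable M Z" "integrable M (\<lambda>\<omega>. (Z \<omega>)\<^sup>2)"
  shows "covariance M Y Z = expectation (\<lambda>\<omega>. Y \<omega> * Z \<omega>) - expectation Y * expectation Z"
proof -
  let ?y = "expectation Y" and ?z = "expectation Z"
  have YZ: "integrable M (\<lambda>\<omega>. Y \<omega> * Z \<omega>)"
    by (rule L2_product) (auto simp: Y Z)
  have "covariance M Y Z = expectation (\<lambda>\<omega>. Y \<omega> * Z \<omega> - ?z * Y \<omega> - ?y * Z \<omega> + ?y * ?z)"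
    by (simp add: covariance_def algebra_simps)
  also have "\<dots> = expectation (\<lambda>\<omega>. Y \<omega> * Z \<omega>) - ?z * ?y - ?y * ?z + ?y * ?z"
    using YZ Y Z by (simp add: prob_space)
  finally show ?thesis by simp
qed

locale stationary_arch = arch_data M \<xi> b for M :: "'w measure" and \<xi> and b +
  fixes a :: real and X :: "int \<Rightarrow> 'w \<Rightarrow> real"
  assumes nonneg_innovation: "AE \<omega> in M. \<xi> k \<omega> \<ge> 0"
    and arch_equations: "arch_solution M a b \<xi> X"
    and stationary: "weakly_stationary M X"
begin

lemma X_L2: "X k \<in> borel_measurable M" "integrable M (X k)" "integrable M (\<lambda>\<omega>. (X k \<omega>)\<^sup>2)"
  using stationary by (simp_all add: weakly_stationary_def)

abbreviation "\<rho> \<equiv> autocovariance M X"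
abbreviation "\<mu> \<equiv> expectation (X 0)"

lemma mean: "expectation (X k) = \<mu>"
  using stationary unfolding weakly_stationary_def by blast

lemma expectation_XX: "expectation (\<lambda>\<omega>. X m \<omega> * X n \<omega>) = \<rho> (n - m) + \<mu>\<^sup>2"
proof -
  have "covariance M (X m) (X (m + (n - m))) = covariance M (X 0) (X (0 + (n - m)))"
    using stationary unfolding weakly_stationary_def by blast
  then show ?thesis
    using covariance_L2[OF X_L2(1) X_L2(1) X_L2(2,3) X_L2(2,3), of m n]
    by (simp add: autocovariance_def mean[of m] mean[of n] power2_eq_square)
qed

lemma autocovariance_even: "\<rho> (- k) = \<rho> k"
  using expectation_XX[of 0 k] expectation_XX[of k 0] by (simp add: mult.commute)

sublocale arch_process M \<xi> b a "expectation (\<lambda>\<omega>. (X 0 \<omega>)\<^sup>2)" X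
proof
  show "expectation (\<lambda>\<omega>. (X k \<omega>)\<^sup>2) \<le> expectation (\<lambda>\<omega>. (X 0 \<omega>)\<^sup>2)" for k
    using expectation_XX[of k k] expectation_XX[of 0 0] by (simp add: power2_eq_square)
qed (simp_all add: nonneg_innovation arch_equations X_L2)

lemma mean_equation: "\<mu> = lam1 * (a + B * \<mu>)"
proof -
  have "(\<Sum>j. b (Suc j) * expectation (\<lambda>\<omega>. X (0 - int (Suc j)) \<omega> * 1)) = B * \<mu>"
    unfolding mult_1_right mean[of "0 - int (Suc _)"] by (rule suminf_mult2[OF summable_b, symmetric])
  then show ?thesis
    using expectation_X_times[of "\<lambda>_. 1" 0] expectation_\<nu>[of 0] by (simp add: prob_space del: of_nat_Suc)
qed

lemma autocovariance_bounded: "\<bar>\<rho> k\<bar> \<le> expectation (\<lambda>\<omega>. (X 0 \<omega>)\<^sup>2) + \<mu>\<^sup>2"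
proof -
  have "\<rho> k + \<mu>\<^sup>2 = expectation (\<lambda>\<omega>. X 0 \<omega> * X k \<omega>)"
    using expectation_XX[of 0 k] by simp
  then have "\<bar>\<rho> k + \<mu>\<^sup>2\<bar> \<le> expectation (\<lambda>\<omega>. \<bar>X 0 \<omega> * X k \<omega>\<bar>)"
    by (metis integral_abs_bound)
  also have "\<dots> \<le> sqrt (expectation (\<lambda>\<omega>. (X 0 \<omega>)\<^sup>2)) * sqrt (expectation (\<lambda>\<omega>. (X k \<omega>)\<^sup>2))"
    by (rule expectation_X_times_le) (auto simp: X_L2)
  also have "expectation (\<lambda>\<omega>. (X k \<omega>)\<^sup>2) = expectation (\<lambda>\<omega>. (X 0 \<omega>)\<^sup>2)"
    using expectation_XX[of k k] expectation_XX[of 0 0] by (simp add: power2_eq_square)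
  finally have "\<bar>\<rho> k + \<mu>\<^sup>2\<bar> \<le> expectation (\<lambda>\<omega>. (X 0 \<omega>)\<^sup>2)"
    using C_nonneg by simp
  then show ?thesis using zero_le_power2[of \<mu>] by linarith
qed

lemma summable_b_autocovariance: "summable (\<lambda>j. norm (b (Suc j) * \<rho> (k - int (Suc j))))"
  by (rule summable_comparison_test'[OF summable_b_times])
    (use autocovariance_bounded b_nonneg in \<open>auto simp: abs_mult intro!: mult_left_mono\<close>)

text \<open>
  Passing from second moments to covariances subtracts \<open>\<mu>\<^sup>2\<close> from each of them; the constants cancel by
  \<open>mean_equation\<close>.
\<close>
lemma autocovariance_equation:
  "\<rho> k = lam1 * (\<Sum>j. b (Suc j) * \<rho> (k - int (Suc j))) + expectation (\<lambda>\<omega>. \<nu> k \<omega> * X 0 \<omega>)"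
proof -
  have XX: "expectation (\<lambda>\<omega>. X i \<omega> * X 0 \<omega>) = \<rho> i + \<mu>\<^sup>2" for i
    using expectation_XX[of i 0] autocovariance_even[of i] by simp
  have "(\<Sum>j. b (Suc j) * (\<rho> (k - int (Suc j)) + \<mu>\<^sup>2))
      = (\<Sum>j. b (Suc j) * \<rho> (k - int (Suc j))) + B * \<mu>\<^sup>2"
    using summable_norm_cancel[OF summable_b_autocovariance[of k]] summable_b
    by (simp add: distrib_left suminf_add[symmetric] suminf_mult2 summable_mult2)
  then have "\<rho> k + \<mu>\<^sup>2 = lam1 * (a * \<mu> + ((\<Sum>j. b (Suc j) * \<rho> (k - int (Suc j))) + B * \<mu>\<^sup>2))
      + expectation (\<lambda>\<omega>. \<nu> k \<omega> * X 0 \<omega>)"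
    using expectation_X_times[OF X_L2(1)[of 0] X_L2(3)[of 0], of k] by (simp add: XX del: of_nat_Suc)
  moreover have "\<mu>\<^sup>2 = lam1 * (a * \<mu> + B * \<mu>\<^sup>2)"
  proof -
    have "\<mu>\<^sup>2 = lam1 * (a + B * \<mu>) * \<mu>"
      unfolding power2_eq_square by (rule arg_cong[OF mean_equation, of "\<lambda>x. x * \<mu>"])
    also have "\<dots> = lam1 * (a * \<mu> + B * \<mu>\<^sup>2)" by (simp add: power2_eq_square algebra_simps)
    finally show ?thesis .
  qed
  ultimately show ?thesis by (simp add: algebra_simps)
qed

theorem yule_walker:
  assumes "k \<ge> 1"
  shows "\<rho> k = lam1 * (\<Sum>j. b (Suc j) * \<rho> (k - int (Suc j)))"
  using autocovariance_equation[of k] \<nu>_uncorrelated[OF X_L2(1) X_L2(3) causal, of 0 k] assms by simp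

text \<open>
  The equations at the times \<open>- n \<le> 0\<close>, together with evenness of \<open>\<rho>\<close>, express \<open>\<rho> n\<close> through later values,
  with \<open>c * z n\<close> added; so \<open>\<rho> 0 = c * (\<Sum>n. (z n)\<^sup>2)\<close>, where \<open>c = sig2 * S\<close> and \<open>S\<close> is the second moment of the
  volatility. On the other hand \<open>\<rho> 0 = lam2 * S - \<mu>\<^sup>2\<close>, and the two expressions for \<open>\<rho> 0\<close> determine \<open>S\<close>.
\<close>
theorem variance_formula:
  "\<rho> 0 = sig2 * (a / (1 - lam1 * B))\<^sup>2 / (1 - sig2 / lam1\<^sup>2 * (\<Sum>n. (z (Suc n))\<^sup>2)) * (\<Sum>n. (z n)\<^sup>2)"
proof -
  define S where "S = expectation (\<lambda>\<omega>. (X 0 \<omega>)\<^sup>2) / lam2"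
  let ?Z = "\<Sum>n. (z (Suc n))\<^sup>2"
  have S: "expectation (\<lambda>\<omega>. (\<Sigma> k \<omega>)\<^sup>2) = S" for k
    using volatility_second_moment(2)[of k] expectation_XX[of k k] expectation_XX[of 0 0] lam2_pos
    by (simp add: S_def power2_eq_square)
  have "\<rho> (int n) = lam1 * (\<Sum>j. b (Suc j) * \<rho> (int (n + Suc j))) + sig2 * S * z n" for n
  proof -
    have "\<rho> (- int n - int (Suc j)) = \<rho> (int (n + Suc j))" for j
    proof -
      have "- int n - int (Suc j) = - int (n + Suc j)" by simp
      then show ?thesis by (simp only: autocovariance_even)
    qed
    then show ?thesis
      using autocovariance_equation[of "- int n"] expectation_\<nu>_X[of "- int n" n]
      by (simp add: autocovariance_even S del: of_nat_Suc of_nat_add)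
  qed
  from weighted_renewal_sum[of lam1 b "\<lambda>n. \<rho> (int n)", OF _ b_nonneg summable_b first_order autocovariance_bounded this]
  have \<rho>0: "\<rho> 0 = sig2 * S * (1 + ?Z)"
    using lam1_pos by (simp add: sum_z2)
  define m where "m = a / (1 - lam1 * B)"
  have \<mu>: "\<mu> = lam1 * m"
    using mean_equation first_order by (simp add: m_def field_simps)
  have "\<rho> 0 + \<mu>\<^sup>2 = lam2 * S"
    using expectation_XX[of 0 0] lam2_pos by (simp add: S_def power2_eq_square)
  then have "lam1\<^sup>2 * m\<^sup>2 = lam1\<^sup>2 * S - sig2 * S * ?Z"
    unfolding \<rho>0 \<mu> by (simp add: sig2_def algebra_simps power_mult_distrib)
  also have "\<dots> = lam1\<^sup>2 * (S * (1 - sig2 / lam1\<^sup>2 * ?Z))"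
    using lam1_pos by (simp add: field_simps)
  finally have "m\<^sup>2 = S * (1 - sig2 / lam1\<^sup>2 * ?Z)"
    using lam1_pos by simp
  moreover have "1 - sig2 / lam1\<^sup>2 * ?Z > 0"
    using second_order lam1_pos by (simp add: field_simps)
  ultimately have S_eq: "S = m\<^sup>2 / (1 - sig2 / lam1\<^sup>2 * ?Z)"
    by (metis eq_divide_imp less_irrefl)
  have "\<rho> 0 = sig2 * (m\<^sup>2 / (1 - sig2 / lam1\<^sup>2 * ?Z)) * (1 + ?Z)"
    using \<rho>0 unfolding S_eq .
  then have "\<rho> 0 = sig2 * m\<^sup>2 / (1 - sig2 / lam1\<^sup>2 * ?Z) * (1 + ?Z)"
    by (simp only: times_divide_eq_right)
  then have "\<rho> 0 = sig2 * m\<^sup>2 / (1 - sig2 / lam1\<^sup>2 * ?Z) * (\<Sum>n. (z n)\<^sup>2)"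
    by (simp only: sum_z2)
  then show ?thesis by (simp only: m_def)
qed

end

theorem proposition1:
  fixes M :: "'w measure"
    and \<xi> X :: "int \<Rightarrow> 'w \<Rightarrow> real"
    and a lam1 \<sigma> B \<Omega> :: real
    and b z :: "nat \<Rightarrow> real"
    and \<rho> :: "int \<Rightarrow> real"
  assumes "prob_space M"
    and "iid M \<xi>"
    and "\<And>k. AE \<omega> in M. \<xi> k \<omega> \<ge> 0"
    and "integrable M (\<xi> 0)"
    and "integrable M (\<lambda>\<omega>. (\<xi> 0 \<omega>)\<^sup>2)"
    and "lam1 = prob_space.expectation M (\<xi> 0)" and "lam1 > 0"
    and "\<sigma> = sqrt (prob_space.variance M (\<xi> 0))" and "\<sigma> > 0"
    and "a > 0"
    and "\<And>j. j \<ge> 1 \<Longrightarrow> b j \<ge> 0"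
    and "\<exists>j\<ge>1. b j \<noteq> 0"
    and "summable (\<lambda>j. b (Suc j))"
    and "B = (\<Sum>j. b (Suc j))"
    and "z = arch_z lam1 b"
    and "\<Omega> = arch_Omega \<sigma> lam1 b"
    and "lam1 * B < 1"
    and "\<Omega> < 1"
    and "arch_solution M a b \<xi> X"
    and "weakly_stationary M X"
    and "\<rho> = autocovariance M X"
  shows "(\<forall>k\<ge>1. (\<lambda>j. b (nat (k - j)) * \<rho> j) summable_on {..k - 1} \<and>
                \<rho> k = lam1 * (\<Sum>\<^sub>\<infinity>j\<in>{..k - 1}. b (nat (k - j)) * \<rho> j)) \<and>
         (\<forall>k\<le>-1. \<rho> k = \<rho> (- k)) \<and>
         summable (\<lambda>j. (z j)\<^sup>2) \<and>
         \<rho> 0 = (a * \<sigma> / (1 - lam1 * B))\<^sup>2 * (1 / (1 - \<Omega>\<^sup>2)) * (\<Sum>j. (z j)\<^sup>2) \<and>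
         (a * \<sigma> / (1 - lam1 * B))\<^sup>2 * (1 / (1 - \<Omega>\<^sup>2)) * (\<Sum>j. (z j)\<^sup>2)
           = (a * \<sigma> / (1 - lam1 * B))\<^sup>2 * ((1 + lam1\<^sup>2 * \<Omega>\<^sup>2 / \<sigma>\<^sup>2) / (1 - \<Omega>\<^sup>2))"
proof -
  interpret prob_space M by (rule assms(1))
  interpret I: iid_innovations M \<xi>
    by unfold_locales (rule assms(2), rule assms(4), rule assms(5))
  have lam1: "I.lam1 = lam1" unfolding I.lam1_def by (rule assms(6)[symmetric])
  have \<sigma>2: "\<sigma>\<^sup>2 = I.sig2"
    unfolding assms(8) using variance_positive[of "\<xi> 0"] by simp
  have sz2: "summable (\<lambda>n. (z n)\<^sup>2)"
    unfolding \<open>z = _\<close>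
    by (intro summable_power2_of_summable summable_arch_z arch_z_nonneg) (use assms in auto)
  have Z0: "0 \<le> (\<Sum>n. (z (Suc n))\<^sup>2)"
    by (rule suminf_nonneg) (use sz2 in \<open>simp_all add: summable_Suc_iff[of "\<lambda>n. (z n)\<^sup>2"]\<close>)
  have \<Omega>: "\<Omega> = \<sigma> / lam1 * sqrt (\<Sum>n. (z (Suc n))\<^sup>2)"
    using assms by (simp add: arch_Omega_def)
  have \<Omega>0: "0 \<le> \<Omega>" unfolding \<Omega> using Z0 assms by simp
  have \<Omega>2: "\<Omega>\<^sup>2 = I.sig2 / lam1\<^sup>2 * (\<Sum>n. (z (Suc n))\<^sup>2)"
    unfolding \<Omega> \<sigma>2[symmetric] using Z0 by (simp add: power_mult_distrib power_divide)
  have \<Omega>2_less: "\<Omega>\<^sup>2 < 1"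
    using \<Omega>0 \<open>\<Omega> < 1\<close> by (simp add: power_less_one_iff)
  interpret stationary_arch M \<xi> b a X
  proof
    show "I.sig2 * (\<Sum>j. (arch_z I.lam1 b (Suc j))\<^sup>2) < I.lam1\<^sup>2"
      using \<Omega>2_less \<open>lam1 > 0\<close> unfolding \<Omega>2 lam1 \<open>z = _\<close> by (simp add: field_simps)
    show "I.sig2 > 0" unfolding \<sigma>2[symmetric] using \<open>\<sigma> > 0\<close> by simp
    show "I.lam1 > 0" unfolding lam1 by fact
    show "I.lam1 * (\<Sum>j. b (Suc j)) < 1" using assms(14,17) unfolding lam1 by simp
  qed (fact assms)+
  have \<rho>: "\<rho> = autocovariance M X" by fact
  have sum_z2: "(\<Sum>n. (z n)\<^sup>2) = 1 + (\<Sum>n. (z (Suc n))\<^sup>2)"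
    using sum_z2 unfolding lam1 \<open>z = _\<close> .
  have yw: "(\<lambda>j. b (nat (k - j)) * \<rho> j) summable_on {..k - 1} \<and>
      \<rho> k = lam1 * (\<Sum>\<^sub>\<infinity>j\<in>{..k - 1}. b (nat (k - j)) * \<rho> j)" if k: "k \<ge> 1" for k
  proof -
    \<comment> \<open>the lag \<open>Suc j\<close> belongs to the time \<open>k - int (Suc j)\<close>\<close>
    have bij: "bij_betw (\<lambda>j. k - int (Suc j)) UNIV {..k - 1}"
      by (rule bij_betw_byWitness[where f' = "\<lambda>i. nat (k - 1 - i)"]) auto
    have eq: "b (nat (k - (k - int (Suc j)))) * \<rho> (k - int (Suc j)) = b (Suc j) * \<rho> (k - int (Suc j))" for j
      by (simp del: of_nat_Suc)
    have sum: "summable (\<lambda>j. norm (b (Suc j) * \<rho> (k - int (Suc j))))"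
      unfolding \<rho> by (rule summable_b_autocovariance)
    have "(\<lambda>j. b (nat (k - j)) * \<rho> j) summable_on {..k - 1}"
      using summable_on_reindex_bij_betw[OF bij, of "\<lambda>j. b (nat (k - j)) * \<rho> j"]
        norm_summable_imp_summable_on[OF sum] unfolding eq by blast
    moreover have "(\<Sum>\<^sub>\<infinity>j\<in>{..k - 1}. b (nat (k - j)) * \<rho> j) = (\<Sum>j. b (Suc j) * \<rho> (k - int (Suc j)))"
      using infsum_reindex_bij_betw[OF bij, of "\<lambda>j. b (nat (k - j)) * \<rho> j"]
        infsum_UNIV_eq_suminf[OF sum] unfolding eq by simp
    ultimately show ?thesis using yule_walker[OF k] by (simp add: \<rho> lam1)
  qed
  have "\<rho> 0 = \<sigma>\<^sup>2 * (a / (1 - lam1 * B))\<^sup>2 / (1 - \<Omega>\<^sup>2) * (\<Sum>j. (z j)\<^sup>2)"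
    using variance_formula unfolding \<rho> \<Omega>2 \<sigma>2 lam1 \<open>z = _\<close> \<open>B = _\<close> .
  then have var: "\<rho> 0 = (a * \<sigma> / (1 - lam1 * B))\<^sup>2 * (1 / (1 - \<Omega>\<^sup>2)) * (\<Sum>j. (z j)\<^sup>2)"
    by (simp add: power_mult_distrib power_divide mult_ac)
  have "(\<Sum>j. (z j)\<^sup>2) = 1 + lam1\<^sup>2 * \<Omega>\<^sup>2 / \<sigma>\<^sup>2"
    unfolding sum_z2 \<Omega>2 \<sigma>2[symmetric] using \<open>lam1 > 0\<close> \<open>\<sigma> > 0\<close> by simp
  then have sum_\<Omega>: "(a * \<sigma> / (1 - lam1 * B))\<^sup>2 * (1 / (1 - \<Omega>\<^sup>2)) * (\<Sum>j. (z j)\<^sup>2)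
      = (a * \<sigma> / (1 - lam1 * B))\<^sup>2 * ((1 + lam1\<^sup>2 * \<Omega>\<^sup>2 / \<sigma>\<^sup>2) / (1 - \<Omega>\<^sup>2))"
    by simp
  show ?thesis
    using yw sz2 var sum_\<Omega> autocovariance_even by (auto simp: \<rho>)
qed

end
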